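(* Let $|\omega|=n$ be even, let $i\in Y_0$ and let $q$ be a positive integer. Define the linear map $$\Phi_i^{(q)}:\mathcal{H}\to\mathcal{W},\qquad \mathrm{D_H}(f)\mapsto\partial_i^{p^q}(f)\,\mathrm{D_H}(x^{\omega}).$$ Then $\Phi_i^{(q)}\in\mathrm{Der}(\mathcal{H},\mathcal{W})$.
   Context: Let $\mathbb{F}$ be a field of characteristic $p>3$, and let $m>1$, $n>3$ be integers. Put $Y_0=\{1,\dots,2m\}$, $Y_1=\{2m+1,\dots,2m+n\}$, $Y=Y_0\cup Y_1$. Fix $\underline t=(t_1,\dots,t_{2m})$ with positive integer entries, $\pi_i=p^{t_i}-1$, $\pi=(\pi_1,\dots,\pi_{2m})$, $\mathbb{A}=\{\alpha\in\mathbb{N}_0^{2m}:\alpha_i\le\pi_i\}$, $|\alpha|=\sum\alpha_i$; $\varepsilon_i$ is the $i$-th unit vector. $\mathbb{B}_k$ is the set of strictly increasing $k$-tuples $u=\langle i_1,\dots,i_k\rangle$ in $Y_1$ (also viewed as subsets), $|u|=k$, $\mathbb{B}=\bigcup_{k=0}^n\mathbb{B}_k$, $\mathbb{B}^0=\{u\in\mathbb{B}: |u|\text{ even}\}$, $x^u=x_{i_1}\cdots x_{i_k}$, $x^{\emptyset}=1$, $\omega=\langle 2m+1,\dots,2m+n\rangle$ (so $|\omega|=n$). $\mathcal{O}=\mathcal{O}(2m,n;\underline t)$ is the associative superalgebra with basis $\{x^{(\alpha)}x^u:\alpha\in\mathbb{A},u\in\mathbb{B}\}$ and products $x^{(\alpha)}x^{(\beta)}=\prod_i\binom{\alpha_i+\beta_i}{\alpha_i}x^{(\alpha+\beta)}$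 (zero if $\alpha+\beta\notin\mathbb{A}$), $x_kx_l=-x_lx_k$, $x_k^2=0$ for $k,l\in Y_1$, $x^{(\alpha)}x_k=x_kx^{(\alpha)}$; write $x_i=x^{(\varepsilon_i)}$ for $i\in Y_0$. The parity of $x^{(\alpha)}x^u$ is $|u|$ mod 2 and its $\mathbb{Z}$-degree is $|\alpha|+|u|$. The superderivations $\partial_i$ ($i\in Y$) are $\partial_i(x^{(\alpha)}x^u)=x^{(\alpha-\varepsilon_i)}x^u$ for $i\in Y_0$ (zero if $\alpha_i=0$), and $\partial_i(x^{(\alpha)}x^u)=x^{(\alpha)}\,\partial x^u/\partial x_i$ (left derivative) for $i\in Y_1$; $\mu(i)=\overline 0$ for $i\in Y_0$, $\mu(i)=\overline 1$ for $i\in Y_1$ is the parity of $\partial_i$. $W=\{\sum_{i\in Y}a_i\partial_i: a_i\in\mathcal{O}\}$ is the generalized Witt Lie superalgebra (an $\mathcal{O}$-module), with bracket $[a\partial_i,b\partial_j]=a\partial_i(b)\partial_j-(-1)^{\mathrm p(a\partial_i)\mathrm p(b\partial_j)}b\partial_j(a)\partial_i$, where $\mathrm p(a\partial_i)=\mathrm p(a)+\mu(i)$. $\mathcal{W}$ is the even part of $W$. For $i\in Y_0$: $i'=i+m$, $\tau(i)=1$ if $i\le m$; $i'=i-m$, $\tau(i)=-1$ if $m<i\le 2m$; for $i\in Y_1$: $i'=i$, $\tau(i)=1$. Define the linear map $\mathrm{D_H}:\mathcal{O}\to W$ by $\mathrm{D_H}(a)=\sum_{i\in Y}\tau(i)(-1)^{\mu(i)\mathrm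 p(a)}\partial_i(a)\partial_{i'}$ for homogeneous $a$; its kernel is $\mathbb{F}1$. The even part of the Hamiltonian superalgebra is $$\mathcal{H}=\mathrm{span}_{\mathbb{F}}\{\mathrm{D_H}(x^{(\alpha)}x^u):\alpha\in\mathbb{A},u\in\mathbb{B}^0,(\alpha,u)\ne(\pi,\omega)\}\subset\mathcal{W}.$$ In the definition of $\Phi_i^{(q)}$, $f$ ranges over the span of the $x^{(\alpha)}x^u$ with $\alpha\in\mathbb{A}$, $u\in\mathbb{B}^0$, $(\alpha,u)\ne(\pi,\omega)$; the map is well defined since $\ker\mathrm{D_H}=\mathbb{F}1$. A derivation from $\mathcal{H}$ into $\mathcal{W}$ is a linear map $D$ with $D([x,y])=[x,D(y)]-[y,D(x)]$ for all $x,y\in\mathcal{H}$; the space of these is $\mathrm{Der}(\mathcal{H},\mathcal{W})$. *)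

theory Defs
  imports
    Complex_Main
    "HOL-Library.Function_Algebras"
begin

text \<open>
  A basis monomial \<open>x^(\<alpha>) x^u\<close> is the pair \<open>(\<alpha>, u)\<close>, where \<open>\<alpha>\<close> vanishes outside \<open>Y0 m\<close> and the
  increasing tuple \<open>u\<close> is given by its set of entries.  Elements of \<open>\<O>(2m,n;t)\<close> are
  coefficient functions on monomials supported on the basis.  An element \<open>\<Sum>i. a i \<partial>\<^sub>i\<close> of the
  generalized Witt superalgebra \<open>W\<close>, which is free over \<open>\<O>\<close> on the \<open>\<partial>\<^sub>i\<close>, is its coefficient
  family \<open>a\<close>.  Sums, differences and zero of both kinds of objects are pointwise; the product of
  \<open>\<O>\<close> is \<open>omul\<close> below, not the pointwise product of functions.
\<close>

type_synonym mono = "(nat \<Rightarrow> nat) \<times> nat set"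
type_synonym 'a osup = "mono \<Rightarrow> 'a"
type_synonym 'a wsup = "nat \<Rightarrow> mono \<Rightarrow> 'a"

definition oscale :: "'a::field \<Rightarrow> 'a osup \<Rightarrow> 'a osup" where
  "oscale c f = (\<lambda>b. c * f b)"

definition wscale :: "'a::field \<Rightarrow> 'a wsup \<Rightarrow> 'a wsup" where
  "wscale c A = (\<lambda>k. oscale c (A k))"

interpretation ospace: vector_space oscale
  by unfold_locales (auto simp: oscale_def fun_eq_iff algebra_simps)

interpretation wspace: vector_space wscale
  by unfold_locales (auto simp: wscale_def oscale_def fun_eq_iff algebra_simps)

definition mon :: "(nat \<Rightarrow> nat) \<Rightarrow> nat set \<Rightarrow> 'a::field osup" where
  "mon \<alpha> u = (\<lambda>b. if b = (\<alpha>, u) then 1 else 0)"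

definition unitv :: "nat \<Rightarrow> nat \<Rightarrow> nat" where
  "unitv i = (\<lambda>j. if j = i then 1 else 0)"

definition Y0 :: "nat \<Rightarrow> nat set" where "Y0 m = {1..2 * m}"
definition Y1 :: "nat \<Rightarrow> nat \<Rightarrow> nat set" where "Y1 m n = {2 * m + 1..2 * m + n}"
definition YY :: "nat \<Rightarrow> nat \<Rightarrow> nat set" where "YY m n = Y0 m \<union> Y1 m n"

text \<open>\<open>\<mu>(i)\<close>, \<open>\<tau>(i)\<close> and \<open>i'\<close>, for indices \<open>i \<in> YY m n\<close>.\<close>

definition par :: "nat \<Rightarrow> nat \<Rightarrow> nat" where
  "par m i = (if i \<in> Y0 m then 0 else 1)"

definition tau :: "nat \<Rightarrow> nat \<Rightarrow> 'a::field" where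
  "tau m i = (if m < i \<and> i \<le> 2 * m then - 1 else 1)"

definition prm :: "nat \<Rightarrow> nat \<Rightarrow> nat" where
  "prm m i = (if i \<le> m then i + m else if i \<le> 2 * m then i - m else i)"

context
  fixes p m n :: nat and t :: "nat \<Rightarrow> nat"
begin

definition ppi :: "nat \<Rightarrow> nat" where
  "ppi = (\<lambda>i. if i \<in> Y0 m then p ^ t i - 1 else 0)"

definition AA :: "(nat \<Rightarrow> nat) set" where
  "AA = {\<alpha>. (\<forall>i\<in>Y0 m. \<alpha> i \<le> ppi i) \<and> (\<forall>i. i \<notin> Y0 m \<longrightarrow> \<alpha> i = 0)}"

definition BB :: "nat set set" where "BB = Pow (Y1 m n)"
definition BB0 :: "nat set set" where "BB0 = {u \<in> BB. even (card u)}"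

definition Oalg :: "'a::field osup set" where
  "Oalg = {f. \<forall>b. b \<notin> AA \<times> BB \<longrightarrow> f b = 0}"

definition hpart :: "nat \<Rightarrow> 'a::field osup \<Rightarrow> 'a osup" where
  "hpart r f = (\<lambda>(\<alpha>, u). if card u mod 2 = r then f (\<alpha>, u) else 0)"

text \<open>Moving \<open>x^v\<close> past \<open>x^u\<close> into increasing order costs one sign per inversion.\<close>

definition mmul :: "mono \<Rightarrow> mono \<Rightarrow> 'a::field osup" where
  "mmul = (\<lambda>(\<alpha>, u) (\<beta>, v).
     if \<alpha> + \<beta> \<in> AA \<and> u \<inter> v = {}
     then oscale (of_nat (\<Prod>i\<in>Y0 m. (\<alpha> i + \<beta> i) choose \<alpha> i)
                  * (- 1) ^ card {(k, l). k \<in> u \<and> l \<in> v \<and> l < k})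
            (mon (\<alpha> + \<beta>) (u \<union> v))
     else 0)"

definition omul :: "'a::field osup \<Rightarrow> 'a osup \<Rightarrow> 'a osup" where
  "omul f g = (\<Sum>b\<in>AA \<times> BB. \<Sum>c\<in>AA \<times> BB. oscale (f b * g c) (mmul b c))"

definition mder :: "nat \<Rightarrow> mono \<Rightarrow> 'a::field osup" where
  "mder i = (\<lambda>(\<alpha>, u).
     if i \<in> Y0 m then (if \<alpha> i = 0 then 0 else mon (\<lambda>j. \<alpha> j - unitv i j) u)
     else (if i \<in> u then oscale ((- 1) ^ card {k \<in> u. k < i}) (mon \<alpha> (u - {i})) else 0))"

definition der :: "nat \<Rightarrow> 'a::field osup \<Rightarrow> 'a osup" where
  "der i f = (\<Sum>b\<in>AA \<times> BB. oscale (f b) (mder i b))"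

definition elt :: "'a::field osup \<Rightarrow> nat \<Rightarrow> 'a wsup" where
  "elt a i = (\<lambda>k. if k = i then a else 0)"

definition wact :: "'a::field osup \<Rightarrow> 'a wsup \<Rightarrow> 'a wsup" where
  "wact f A = (\<lambda>k. omul f (A k))"

text \<open>The bracket of \<open>a \<partial>\<^sub>i\<close> and \<open>b \<partial>\<^sub>j\<close> for \<open>a\<close>, \<open>b\<close> homogeneous of parity \<open>r\<close>, \<open>s\<close>.\<close>

definition hbracket ::
    "nat \<Rightarrow> 'a::field osup \<Rightarrow> nat \<Rightarrow> nat \<Rightarrow> 'a osup \<Rightarrow> nat \<Rightarrow> 'a wsup" where
  "hbracket r a i s b j =
     elt (omul a (der i b)) j
     - wscale ((- 1) ^ ((r + par m i) * (s + par m j))) (elt (omul b (der j a)) i)"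

definition bracket :: "'a::field wsup \<Rightarrow> 'a wsup \<Rightarrow> 'a wsup" where
  "bracket A B = (\<Sum>i\<in>YY m n. \<Sum>j\<in>YY m n. \<Sum>r\<in>{0, 1}. \<Sum>s\<in>{0, 1}.
     hbracket r (hpart r (A i)) i s (hpart s (B j)) j)"

definition Wsup :: "'a::field wsup set" where
  "Wsup = {A. (\<forall>i\<in>YY m n. A i \<in> Oalg) \<and> (\<forall>i. i \<notin> YY m n \<longrightarrow> A i = 0)}"

definition Weven :: "'a::field wsup set" where
  "Weven = {A \<in> Wsup. \<forall>i\<in>YY m n. hpart (par m i) (A i) = A i}"

definition DH :: "'a::field osup \<Rightarrow> 'a wsup" where
  "DH a = (\<Sum>r\<in>{0, 1}. \<Sum>i\<in>YY m n.
     wscale (tau m i * (- 1) ^ (par m i * r)) (elt (der i (hpart r a)) (prm m i)))"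

definition Hidx :: "mono set" where
  "Hidx = AA \<times> BB0 - {(ppi, Y1 m n)}"

definition HH :: "'a::field wsup set" where
  "HH = wspace.span ((\<lambda>(\<alpha>, u). DH (mon \<alpha> u)) ` Hidx)"

definition Hpre :: "'a::field osup set" where
  "Hpre = ospace.span ((\<lambda>(\<alpha>, u). mon \<alpha> u) ` Hidx)"

text \<open>\<open>Der(\<H>, \<W>)\<close>: only the values on \<open>\<H>\<close> are constrained.\<close>

definition DerHW :: "('a::field wsup \<Rightarrow> 'a wsup) set" where
  "DerHW = {D. (\<forall>x\<in>HH. D x \<in> Weven)
     \<and> (\<forall>x\<in>HH. \<forall>y\<in>HH. D (x + y) = D x + D y)
     \<and> (\<forall>c. \<forall>x\<in>HH. D (wscale c x) = wscale c (D x))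
     \<and> (\<forall>x\<in>HH. \<forall>y\<in>HH. D (bracket x y) = bracket x (D y) - bracket y (D x))}"

text \<open>The choice of the preimage \<open>f\<close> is immaterial, see \<open>Phi_DH\<close> below.\<close>

definition Phi :: "nat \<Rightarrow> nat \<Rightarrow> 'a::field wsup \<Rightarrow> 'a wsup" where
  "Phi i q X =
     (let f = (SOME f. f \<in> Hpre \<and> DH f = X)
      in wact ((der i ^^ (p ^ q)) f) (DH (mon 0 (Y1 m n))))"

lemma osum_apply: "(\<Sum>b\<in>S. (F b :: 'c \<Rightarrow> 'd::comm_monoid_add)) k = (\<Sum>b\<in>S. F b k)"
  by (induction S rule: infinite_finite_induct) auto

lemma der_hparts:
  "der i (hpart 0 f) + der i (hpart 1 f) = (der i f :: 'a::field osup)"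
proof -
  have "hpart 0 f b + hpart 1 f b = f b" for b
    by (cases b) (auto simp: hpart_def)
  then show ?thesis
    unfolding der_def
    by (simp add: sum.distrib [symmetric] ospace.scale_left_distrib [symmetric])
qed

lemma DH_prm:
  assumes "i \<in> Y0 m"
  shows "DH f (prm m i) = oscale (tau m i) (der i f :: 'a::field osup)"
proof -
  have eq: "prm m j = prm m i \<longleftrightarrow> j = i" if "j \<in> YY m n" for j
    using assms that by (auto simp: prm_def YY_def Y0_def Y1_def split: if_splits)
  have fin: "finite (YY m n)" and i: "i \<in> YY m n"
    using assms by (auto simp: YY_def Y0_def Y1_def)
  have part: "(\<Sum>j\<in>YY m n. wscale (tau m j * (- 1) ^ (par m j * r))
          (elt (der j (hpart r f)) (prm m j))) (prm m i)
        = oscale (tau m i) (der i (hpart r f))" for r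
  proof -
    have "(\<Sum>j\<in>YY m n. wscale (tau m j * (- 1) ^ (par m j * r))
          (elt (der j (hpart r f)) (prm m j))) (prm m i)
        = (\<Sum>j\<in>YY m n. if j = i then oscale (tau m i) (der i (hpart r f)) else 0)"
      unfolding osum_apply [where k = "prm m i"]
    proof (rule sum.cong)
      fix j assume "j \<in> YY m n"
      with eq [of j] show "wscale (tau m j * (- 1) ^ (par m j * r))
            (elt (der j (hpart r f)) (prm m j)) (prm m i)
          = (if j = i then oscale (tau m i) (der i (hpart r f)) else 0)"
        using assms by (auto simp: wscale_def elt_def par_def ospace.scale_zero_right)
    qed simp
    then show ?thesis using fin i by simp
  qed
  have "DH f (prm m i)
      = oscale (tau m i) (der i (hpart 0 f)) + oscale (tau m i) (der i (hpart 1 f))"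
    unfolding DH_def using part [of 0] part [of 1]
    by (simp add: osum_apply [where k = "prm m i"])
  then show ?thesis
    by (simp only: ospace.scale_right_distrib [symmetric] der_hparts)
qed

lemma Phi_DH:
  assumes "i \<in> Y0 m" "p > 0" "f \<in> Hpre"
  shows "Phi i q (DH f) =
    wact ((der i ^^ (p ^ q)) f) (DH (mon 0 (Y1 m n)) :: 'a::field wsup)"
proof -
  define g where "g = (SOME g. g \<in> Hpre \<and> DH g = DH f)"
  have "g \<in> Hpre \<and> DH g = DH f"
    unfolding g_def by (rule someI [of _ f]) (use assms in simp)
  then have "oscale (tau m i) (der i g) = oscale (tau m i) (der i f)"
    using DH_prm [OF assms(1)] by metis
  then have d: "der i g = der i f"
    by (auto simp: tau_def ospace.scale_minus_left split: if_splits)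
  obtain k where "p ^ q = Suc k"
    using assms(2) by (metis gr0_implies_Suc zero_less_power)
  then have "(der i ^^ (p ^ q)) g = (der i ^^ (p ^ q)) f"
    by (simp only: funpow_Suc_right o_apply d)
  then show ?thesis
    unfolding Phi_def g_def [symmetric] by simp
qed

end

end

theory Submission
  imports Defs "HOL-Computational_Algebra.Primes"
begin

text \<open>
  Write \<open>{f, g}\<close> for the Poisson bracket \<open>D_H(f)(g)\<close>, \<open>T\<close> for \<open>\<partial>_i^(p^q)\<close> and \<open>E\<close> for
  \<open>D_H(x^\<omega>)\<close>; all of \<open>f\<close>, \<open>g\<close>, \<open>h\<close> below are even, and so is \<open>x^\<omega>\<close> because \<open>n\<close> is even.
  The claim follows from four facts.

  \<^item> \<open>[D_H(f), D_H(g)] = D_H({f, g})\<close> (\<open>bracket_DH\<close>), and \<open>{f, g}\<close> never involves the top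
    monomial \<open>x^(\<pi>) x^\<omega>\<close> (\<open>poisson_in_Hpre\<close>), because it is a sum of derivatives and no
    derivative reaches a monomial that is maximal in every variable.

  \<^item> \<open>{f, x^\<omega>} = 0\<close> (\<open>poisson_top_monomial\<close>): an even exterior monomial \<open>x^u\<close> containing \<open>k\<close> keeps
    another factor \<open>x_l\<close> after \<open>\<partial>_k\<close>, and \<open>x_l\<close> annihilates \<open>\<partial>_k x^\<omega>\<close>.  Hence \<open>D_H(f)\<close> commutes
    with \<open>E\<close>, and \<open>[D_H(f), h E] = {f, h} E\<close> (\<open>bracket_DH_wact\<close>).

  \<^item> \<open>T\<close> is an even derivation of the algebra, since the inner binomial coefficients of order
    \<open>p^q\<close> vanish in characteristic \<open>p\<close>, and it commutes with every \<open>\<partial>_j\<close>.  So it is a derivation of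
    the Poisson bracket (\<open>der_prime_power_poisson\<close>).

  \<^item> \<open>{g, f} = - {f, g}\<close> (\<open>poisson_skew\<close>).

  With \<open>\<Phi>(D_H(f)) = T(f) E\<close> the two sides of the derivation identity for \<open>D_H(f)\<close> and \<open>D_H(g)\<close> are
  \<open>T({f, g}) E\<close> and \<open>({f, T(g)} - {g, T(f)}) E\<close>, and these agree.

  All identities of the superalgebra are multilinear, so they are checked on monomials.  There the
  exterior part contributes signs counted by inversions, and the divided power part contributes
  binomial coefficients.  The Leibniz rule for \<open>\<partial>_i\<close>, \<open>i \<in> Y0\<close>, is Pascal's rule, and it is
  compatible with the truncation \<open>\<alpha>_i < p^(t_i)\<close> exactly because the characteristic is \<open>p\<close>.
\<close>

section \<open>Signs of exterior monomials\<close>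

definition inversions :: "nat set \<Rightarrow> nat set \<Rightarrow> nat" where
  "inversions u v = card {(k, l). k \<in> u \<and> l \<in> v \<and> l < k}"

text \<open>
  The sign in \<open>x^u x^v = \<plusminus> x^(u \<union> v)\<close>; it is \<open>0\<close> for overlapping \<open>u\<close> and \<open>v\<close> because \<open>x_k^2 = 0\<close>.
\<close>

definition shuffle_sign :: "nat set \<Rightarrow> nat set \<Rightarrow> 'a::field" where
  "shuffle_sign u v = (if u \<inter> v = {} then (- 1) ^ inversions u v else 0)"

text \<open>
  The left derivative first moves \<open>x_i\<close> to the front of \<open>x^u\<close>, past all factors of smaller index.
\<close>

definition removal_sign :: "nat \<Rightarrow> nat set \<Rightarrow> 'a::field" where
  "removal_sign i u = (if i \<in> u then (- 1) ^ inversions {i} u else 0)"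

lemma finite_inversion_set [simp]:
  "finite u \<Longrightarrow> finite v \<Longrightarrow> finite {(k, l). k \<in> u \<and> l \<in> v \<and> (l::nat) < k}"
  by (rule finite_subset [of _ "u \<times> v"]) auto

lemma inversions_Un_left:
  assumes "finite u" "finite u'" "finite v" "u \<inter> u' = {}"
  shows "inversions (u \<union> u') v = inversions u v + inversions u' v"
proof -
  have "{(k, l). k \<in> u \<union> u' \<and> l \<in> v \<and> l < k}
      = {(k, l). k \<in> u \<and> l \<in> v \<and> l < k} \<union> {(k, l). k \<in> u' \<and> l \<in> v \<and> l < k}" by auto
  then show ?thesis
    unfolding inversions_def using assms by (simp add: card_Un_disjoint disjoint_iff)
qed

lemma inversions_Un_right:
  assumes "finite u" "finite v" "finite v'" "v \<inter> v' = {}"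
  shows "inversions u (v \<union> v') = inversions u v + inversions u v'"
proof -
  have "{(k, l). k \<in> u \<and> l \<in> v \<union> v' \<and> l < k}
      = {(k, l). k \<in> u \<and> l \<in> v \<and> l < k} \<union> {(k, l). k \<in> u \<and> l \<in> v' \<and> l < k}" by auto
  then show ?thesis
    unfolding inversions_def using assms by (simp add: card_Un_disjoint disjoint_iff)
qed

text \<open>
  A pair with distinct entries is an inversion in exactly one of the two orders.
\<close>

lemma inversions_add_swap:
  assumes "finite u" "finite v" "u \<inter> v = {}"
  shows "inversions u v + inversions v u = card u * card v"
proof -
  have "u \<times> v = {(k, l). k \<in> u \<and> l \<in> v \<and> l < k}
      \<union> prod.swap ` {(k, l). k \<in> v \<and> l \<in> u \<and> l < k}"
    (is "_ = ?A \<union> prod.swap ` ?B")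
  proof (rule set_eqI)
    fix x :: "nat \<times> nat"
    obtain k l where x: "x = (k, l)" by fastforce
    have "x \<in> prod.swap ` ?B \<longleftrightarrow> k \<in> u \<and> l \<in> v \<and> k < l"
      unfolding x by (auto simp: image_iff)
    then show "x \<in> u \<times> v \<longleftrightarrow> x \<in> ?A \<union> prod.swap ` ?B"
      using assms(3) unfolding x by (auto simp: disjoint_iff not_less_iff_gr_or_eq)
  qed
  moreover have "card (prod.swap ` {(k, l). k \<in> v \<and> l \<in> u \<and> l < k}) = inversions v u"
    unfolding inversions_def by (rule card_image) (simp add: inj_on_def)
  ultimately have "card (u \<times> v) = inversions u v + inversions v u"
    unfolding inversions_def [of u v] using assms by (simp add: card_Un_disjoint disjoint_iff)
  then show ?thesis by (simp add: card_cartesian_product)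
qed

lemma inversions_singleton: "inversions {i} u = card {k \<in> u. k < i}"
proof -
  have "{(k, l). k \<in> {i} \<and> l \<in> u \<and> l < k} = Pair i ` {k \<in> u. k < i}" by auto
  then show ?thesis unfolding inversions_def by (simp add: card_image inj_on_def)
qed

lemma inversions_singleton_Diff: "inversions {i} (u - {i}) = inversions {i} u"
  unfolding inversions_singleton by (rule arg_cong [where f = card]) auto

lemma inversions_remove_left:
  assumes "finite u" "finite v" "i \<in> u"
  shows "inversions u v = inversions {i} v + inversions (u - {i}) v"
  using inversions_Un_left [of "{i}" "u - {i}" v] assms by (simp add: insert_absorb)

lemma inversions_remove_right:
  assumes "finite u" "finite v" "i \<in> v"
  shows "inversions u v = inversions u {i} + inversions u (v - {i})"
  using inversions_Un_right [of u "{i}" "v - {i}"] assms by (simp add: insert_absorb)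

lemma neg_one_power_cong: "even (k + l) \<Longrightarrow> (- 1) ^ k = ((- 1) ^ l :: 'a::field)"
  by (cases "even k") auto

lemma shuffle_sign_assoc:
  assumes "finite u" "finite v" "finite w"
  shows "shuffle_sign u v * shuffle_sign (u \<union> v) w
       = (shuffle_sign v w * shuffle_sign u (v \<union> w) :: 'a::field)"
proof (cases "u \<inter> v = {} \<and> u \<inter> w = {} \<and> v \<inter> w = {}")
  case True
  then show ?thesis
    using assms by (simp add: shuffle_sign_def Int_Un_distrib Int_Un_distrib2
        inversions_Un_left inversions_Un_right power_add)
qed (auto simp: shuffle_sign_def Int_Un_distrib Int_Un_distrib2)

lemma shuffle_sign_swap:
  assumes "finite u" "finite v"
  shows "shuffle_sign v u = ((- 1) ^ (card u * card v) * shuffle_sign u v :: 'a::field)"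
proof (cases "u \<inter> v = {}")
  case True
  then have "even (inversions v u + (card u * card v + inversions u v))"
    using inversions_add_swap [OF assms] by presburger
  from neg_one_power_cong [OF this, where 'a = 'a] True show ?thesis
    by (simp add: shuffle_sign_def Int_commute power_add)
qed (auto simp: shuffle_sign_def)

text \<open>
  The Leibniz rule of an odd derivative on exterior monomials.  The function \<open>M\<close> stands for the
  resulting monomials and keeps track of their index sets.  If \<open>u\<close> and \<open>v\<close> meet exactly in \<open>i\<close>, the
  product vanishes and the two terms on the right cancel.
\<close>

lemma removal_sign_Leibniz:
  fixes M :: "nat set \<Rightarrow> 'a::field"
  assumes fin: "finite u" "finite v"
  shows "shuffle_sign u v * removal_sign i (u \<union> v) * M (u \<union> v - {i})
    = removal_sign i u * shuffle_sign (u - {i}) v * M ((u - {i}) \<union> v)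
      + (- 1) ^ card u * removal_sign i v * shuffle_sign u (v - {i}) * M (u \<union> (v - {i}))"
proof (cases "u \<inter> v - {i} = {}")
  case False
  then show ?thesis by (auto simp: shuffle_sign_def)
next
  case inter: True
  consider "i \<notin> u" "i \<notin> v" | "i \<in> u" "i \<notin> v" | "i \<notin> u" "i \<in> v" | "i \<in> u" "i \<in> v" by blast
  then show ?thesis
  proof cases
    case 1
    then show ?thesis by (simp add: removal_sign_def)
  next
    case 2
    then have "u \<inter> v = {}" "(u - {i}) \<inter> v = {}" "(u - {i}) \<union> v = u \<union> v - {i}"
      using inter by auto
    moreover have "inversions u v + inversions {i} (u \<union> v)
        = inversions {i} u + inversions (u - {i}) v + 2 * inversions {i} v"
      using fin 2 \<open>u \<inter> v = {}\<close> inversions_remove_left [of u v i]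
      by (simp add: inversions_Un_right)
    then have "(- 1) ^ (inversions u v + inversions {i} (u \<union> v))
        = ((- 1) ^ (inversions {i} u + inversions (u - {i}) v) :: 'a)"
      by (intro neg_one_power_cong) presburger
    ultimately show ?thesis using 2
      by (simp add: removal_sign_def shuffle_sign_def power_add)
  next
    case 3
    then have "u \<inter> v = {}" "u \<inter> (v - {i}) = {}" "u \<union> (v - {i}) = u \<union> v - {i}"
      using inter by auto
    moreover have "inversions u v + inversions {i} (u \<union> v)
        = card u + inversions {i} v + inversions u (v - {i})"
      using fin 3 \<open>u \<inter> v = {}\<close> inversions_remove_right [of u v i]
        inversions_add_swap [of u "{i}"]
      by (simp add: inversions_Un_right)
    then have "(- 1) ^ inversions u v * (- 1) ^ inversions {i} (u \<union> v)
        = ((- 1) ^ card u * (- 1) ^ inversions {i} v * (- 1) ^ inversions u (v - {i}) :: 'a)"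
      by (simp flip: power_add)
    ultimately show ?thesis using 3
      by (simp add: removal_sign_def shuffle_sign_def)
  next
    case 4
    then have sets: "u \<inter> v \<noteq> {}" "(u - {i}) \<inter> v = {}" "u \<inter> (v - {i}) = {}"
        "(u - {i}) \<union> v = u \<union> v" "u \<union> (v - {i}) = u \<union> v"
      using inter by auto
    have "inversions (u - {i}) v = inversions (u - {i}) {i} + inversions (u - {i}) (v - {i})"
      "inversions u (v - {i}) = inversions {i} v + inversions (u - {i}) (v - {i})"
      "inversions (u - {i}) {i} + inversions {i} u = card (u - {i})" "card u = Suc (card (u - {i}))"
      using fin 4 inversions_remove_right [of "u - {i}" v i] inversions_remove_left [of u "v - {i}" i]
        inversions_add_swap [of "u - {i}" "{i}"] card_Suc_Diff1 [of u i]
      by (simp_all add: inversions_singleton_Diff)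
    then have "even (inversions {i} u + inversions (u - {i}) v
        + Suc (card u + inversions {i} v + inversions u (v - {i})))"
      by presburger
    from neg_one_power_cong [OF this, where 'a = 'a]
    have "(- 1) ^ inversions {i} u * (- 1) ^ inversions (u - {i}) v
        = - ((- 1) ^ card u * (- 1) ^ inversions {i} v * (- 1) ^ inversions u (v - {i}) :: 'a)"
      by (simp add: power_add)
    with 4 sets show ?thesis by (simp add: removal_sign_def shuffle_sign_def)
  qed
qed

text \<open>
  The two orders of removal agree except for the pair \<open>i\<close>, \<open>j\<close> itself, which is an inversion in only
  one of them.
\<close>

lemma removal_sign_anticommute:
  assumes "finite u" "i \<noteq> j"
  shows "removal_sign i (u - {j}) * removal_sign j u
       = (- (removal_sign j (u - {i}) * removal_sign i u) :: 'a::field)"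
proof (cases "i \<in> u \<and> j \<in> u")
  case True
  have "inversions {i} u = inversions {i} {j} + inversions {i} (u - {j})"
    "inversions {j} u = inversions {j} {i} + inversions {j} (u - {i})"
    "inversions {i} {j} + inversions {j} {i} = 1"
    using assms True inversions_add_swap [of "{i}" "{j}"]
      inversions_remove_right [of "{i}" u j] inversions_remove_right [of "{j}" u i]
    by simp_all
  then have "even (inversions {i} (u - {j}) + inversions {j} u
      + Suc (inversions {j} (u - {i}) + inversions {i} u))"
    by presburger
  from neg_one_power_cong [OF this, where 'a = 'a] show ?thesis
    using True assms(2) by (simp add: removal_sign_def power_add)
qed (use assms(2) in \<open>auto simp: removal_sign_def\<close>)

section \<open>The superalgebra of divided powers and exterior monomials\<close>

(* Elements of the algebra are functions: unfolding their sums pointwise by default would destroy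
   the linear expressions that the rules below rewrite. *)
declare plus_fun_apply [simp del] zero_fun_apply [simp del]

lemma oscale_apply: "oscale c f b = c * f b"
  by (simp add: oscale_def)

lemma mon_apply: "mon \<alpha> u b = (if b = (\<alpha>, u) then 1 else 0)"
  by (simp add: mon_def)

context
  fixes p m n :: nat and t :: "nat \<Rightarrow> nat"
begin

abbreviation A_idx ("\<A>") where "\<A> \<equiv> AA p m t"
abbreviation B_idx ("\<B>") where "\<B> \<equiv> BB m n"
abbreviation top_exponent ("\<pi>") where "\<pi> \<equiv> ppi p m t"
abbreviation Y_idx ("\<Y>") where "\<Y> \<equiv> YY m n"
abbreviation O_alg ("\<O>") where "\<O> \<equiv> Oalg p m n t"
abbreviation O_mult (infixl "\<odot>" 70) where "f \<odot> g \<equiv> omul p m n t f g"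
abbreviation O_der ("\<partial>") where "\<partial> \<equiv> der p m n t"
abbreviation O_scale (infixr "\<bullet>" 75) where "c \<bullet> f \<equiv> oscale c f"

lemma finite_Y0 [simp]: "finite (Y0 m)" and finite_YY [simp]: "finite \<Y>"
  by (simp_all add: Y0_def YY_def Y1_def)

lemma finite_basis [simp]: "finite (\<A> \<times> \<B>)"
proof -
  have "\<A> \<subseteq> {\<alpha>. \<forall>i. (i \<in> Y0 m \<longrightarrow> \<alpha> i \<in> {..Max (\<pi> ` Y0 m)}) \<and> (i \<notin> Y0 m \<longrightarrow> \<alpha> i = 0)}"
    by (auto simp: AA_def intro: order_trans Max_ge)
  then have "finite \<A>"
    by (rule finite_subset) (rule finite_set_of_finite_funs, simp_all)
  then show ?thesis by (simp add: BB_def Y1_def)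
qed

lemma finite_BB [simp]: "u \<in> \<B> \<Longrightarrow> finite u"
  unfolding BB_def Y1_def by (auto intro: finite_subset)

text \<open>
  The structure constants of the divided power part, including the truncation.
\<close>

definition dp_coeff :: "(nat \<Rightarrow> nat) \<Rightarrow> (nat \<Rightarrow> nat) \<Rightarrow> 'a::field" where
  "dp_coeff \<alpha> \<beta> = (if \<alpha> + \<beta> \<in> \<A> then of_nat (\<Prod>i\<in>Y0 m. (\<alpha> i + \<beta> i) choose \<alpha> i) else 0)"

lemma AA_add_left: "\<alpha> + \<beta> \<in> \<A> \<Longrightarrow> \<alpha> \<in> \<A>" and AA_add_right: "\<alpha> + \<beta> \<in> \<A> \<Longrightarrow> \<beta> \<in> \<A>"
  unfolding AA_def plus_fun_apply by (auto dest: add_leD1 add_leD2)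

lemma AA_diff: "\<alpha> \<in> \<A> \<Longrightarrow> \<alpha> - unitv i \<in> \<A>"
  by (auto simp: AA_def le_diff_conv trans_le_add1)

lemma dp_coeff_commute: "dp_coeff \<alpha> \<beta> = (dp_coeff \<beta> \<alpha> :: 'a::field)"
proof -
  have "(\<alpha> i + \<beta> i) choose \<alpha> i = (\<beta> i + \<alpha> i) choose \<beta> i" for i
    using binomial_symmetric [of "\<alpha> i" "\<alpha> i + \<beta> i"] by (simp add: add.commute)
  then show ?thesis by (simp add: dp_coeff_def add.commute)
qed

lemma choose_add_assoc:
  "((a + b) choose a) * ((a + b + c) choose (a + b)) = ((b + c) choose b) * ((a + (b + c)) choose a)"
  using choose_mult_lemma [of b c a] by (simp add: ac_simps)

text \<open>
  A truncated partial product cannot re-enter a triple product, since the admissible exponents are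
  closed under passing to smaller ones; associativity is therefore the one of multinomial
  coefficients.
\<close>

lemma dp_coeff_assoc:
  "dp_coeff \<alpha> \<beta> * dp_coeff (\<alpha> + \<beta>) \<gamma> = (dp_coeff \<beta> \<gamma> * dp_coeff \<alpha> (\<beta> + \<gamma>) :: 'a::field)"
proof (cases "\<alpha> + \<beta> + \<gamma> \<in> \<A>")
  case True
  then have "\<alpha> + \<beta> \<in> \<A>" "\<beta> + \<gamma> \<in> \<A>" "\<alpha> + (\<beta> + \<gamma>) \<in> \<A>"
    using AA_add_left [of "\<alpha> + \<beta>" \<gamma>] AA_add_right [of \<alpha> "\<beta> + \<gamma>"] by (simp_all add: add.assoc)
  with True show ?thesis
    by (simp add: dp_coeff_def choose_add_assoc plus_fun_apply del: of_nat_prod of_nat_mult flip: of_nat_mult prod.distrib)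
next
  case False
  then show ?thesis by (simp add: dp_coeff_def add.assoc)
qed

lemma mmul_eq:
  "mmul p m t (\<alpha>, u) (\<beta>, v) = (dp_coeff \<alpha> \<beta> * shuffle_sign u v) \<bullet> mon (\<alpha> + \<beta>) (u \<union> v)"
  by (simp add: mmul_def dp_coeff_def shuffle_sign_def inversions_def ospace.scale_zero_left)

subsection \<open>Bilinearity and reduction to monomials\<close>

lemma omul_add_left: "(f + f') \<odot> g = f \<odot> g + f' \<odot> (g :: 'a::field osup)"
  and omul_add_right: "f \<odot> (g + g') = f \<odot> g + f \<odot> (g' :: 'a::field osup)"
  and omul_scale_left: "(c \<bullet> f) \<odot> g = c \<bullet> (f \<odot> (g :: 'a::field osup))"
  and omul_scale_right: "f \<odot> (c \<bullet> g) = c \<bullet> (f \<odot> (g :: 'a::field osup))"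
  by (simp_all add: omul_def fun_eq_iff oscale_apply osum_apply plus_fun_apply algebra_simps sum.distrib sum_distrib_left)

lemma der_add: "\<partial> i (f + g) = \<partial> i f + \<partial> i (g :: 'a::field osup)"
  and der_scale: "\<partial> i (c \<bullet> f) = c \<bullet> \<partial> i (f :: 'a::field osup)"
  by (simp_all add: der_def fun_eq_iff oscale_apply osum_apply plus_fun_apply algebra_simps sum.distrib sum_distrib_left)

interpretation omul_left: Vector_Spaces.linear oscale oscale "\<lambda>f. f \<odot> (g :: 'a::field osup)" for g
  by unfold_locales (simp_all add: omul_add_left omul_scale_left)

interpretation omul_right: Vector_Spaces.linear oscale oscale "\<lambda>g. f \<odot> (g :: 'a::field osup)" for f
  by unfold_locales (simp_all add: omul_add_right omul_scale_right)

interpretation der: Vector_Spaces.linear oscale oscale "\<partial> i :: 'a::field osup \<Rightarrow> _" for i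
  by unfold_locales (simp_all add: der_add der_scale)

lemma sum_over_basis_mon:
  assumes "b \<in> \<A> \<times> \<B>"
  shows "(\<Sum>c\<in>\<A> \<times> \<B>. mon (fst b) (snd b) c \<bullet> F c) = (F b :: 'a::field osup)"
proof -
  have "mon (fst b) (snd b) c \<bullet> F c = (if c = b then F c else 0)" for c
    by (auto simp: mon_apply oscale_apply zero_fun_apply fun_eq_iff)
  then show ?thesis using assms by (simp add: sum.delta)
qed

lemma omul_mon:
  assumes "(\<alpha>, u) \<in> \<A> \<times> \<B>" "(\<beta>, v) \<in> \<A> \<times> \<B>"
  shows "mon \<alpha> u \<odot> mon \<beta> v
       = (dp_coeff \<alpha> \<beta> * shuffle_sign u v :: 'a::field) \<bullet> mon (\<alpha> + \<beta>) (u \<union> v)"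
proof -
  have "mon \<alpha> u \<odot> mon \<beta> v
      = (\<Sum>b\<in>\<A> \<times> \<B>. mon \<alpha> u b \<bullet> (\<Sum>c\<in>\<A> \<times> \<B>. mon \<beta> v c \<bullet> (mmul p m t b c :: 'a osup)))"
    unfolding omul_def by (simp add: ospace.scale_sum_right)
  also have "\<dots> = (\<Sum>b\<in>\<A> \<times> \<B>. mon \<alpha> u b \<bullet> mmul p m t b (\<beta>, v))"
    using sum_over_basis_mon [OF assms(2), of "mmul p m t b :: mono \<Rightarrow> 'a osup" for b]
    by (intro sum.cong) simp_all
  also have "\<dots> = mmul p m t (\<alpha>, u) (\<beta>, v)"
    using sum_over_basis_mon [OF assms(1), of "\<lambda>b. mmul p m t b (\<beta>, v) :: 'a osup"] by simp
  finally show ?thesis by (simp add: mmul_eq)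
qed

lemma der_mon_even:
  assumes "(\<alpha>, u) \<in> \<A> \<times> \<B>" "i \<in> Y0 m"
  shows "\<partial> i (mon \<alpha> u :: 'a::field osup) = (if \<alpha> i = 0 then 0 else 1) \<bullet> mon (\<alpha> - unitv i) u"
  using sum_over_basis_mon [OF assms(1), of "mder m i :: mono \<Rightarrow> 'a osup"] assms(2)
  by (simp add: der_def mder_def fun_diff_def ospace.scale_zero_left)

lemma der_mon_odd:
  assumes "(\<alpha>, u) \<in> \<A> \<times> \<B>" "i \<notin> Y0 m"
  shows "\<partial> i (mon \<alpha> u :: 'a::field osup) = removal_sign i u \<bullet> mon \<alpha> (u - {i})"
  using sum_over_basis_mon [OF assms(1), of "mder m i :: mono \<Rightarrow> 'a osup"] assms(2)
  by (simp add: der_def mder_def removal_sign_def inversions_singleton ospace.scale_zero_left)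

text \<open>
  An element is a finite combination of the monomials in its support, so a property that is
  preserved by linear combinations needs to be checked on these monomials only.
\<close>

lemma supported_induct [consumes 2, case_names zero add scale mon]:
  fixes f :: "'a::field osup"
  assumes S: "S \<subseteq> \<A> \<times> \<B>" and f: "\<And>b. b \<notin> S \<Longrightarrow> f b = 0"
    and zero: "P 0" and add: "\<And>f g. P f \<Longrightarrow> P g \<Longrightarrow> P (f + g)"
    and scale: "\<And>c f. P f \<Longrightarrow> P (c \<bullet> f)"
    and mon: "\<And>\<alpha> u. (\<alpha>, u) \<in> S \<Longrightarrow> P (mon \<alpha> u)"
  shows "P f"
proof -
  have fin: "finite S" using S finite_basis by (rule finite_subset)
  have expand: "f = (\<Sum>b\<in>S. f b \<bullet> mon (fst b) (snd b))"
  proof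
    fix c
    have "(\<Sum>b\<in>S. f b \<bullet> mon (fst b) (snd b)) c = (\<Sum>b\<in>S. if c = b then f b else 0)"
      unfolding osum_apply by (rule sum.cong) (auto simp: mon_apply oscale_apply)
    then show "f c = (\<Sum>b\<in>S. f b \<bullet> mon (fst b) (snd b)) c"
      using fin f by simp
  qed
  have "P (\<Sum>b\<in>T. f b \<bullet> mon (fst b) (snd b))" if "finite T" "T \<subseteq> S" for T
    using that
  proof (induction T)
    case (insert b T)
    then show ?case using mon [of "fst b" "snd b"] by (simp add: add scale)
  qed (simp add: zero)
  from this [OF fin order_refl] show ?thesis by (simp only: expand [symmetric])
qed

subsection \<open>Homogeneous elements\<close>

text \<open>
  The elements of parity \<open>r mod 2\<close>.  Since \<open>r\<close> is not reduced modulo 2, parities of products and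
  derivatives are plain sums.
\<close>

definition homog :: "nat \<Rightarrow> 'a::field osup set" where
  "homog r = {f. \<forall>\<alpha> u. f (\<alpha>, u) \<noteq> 0 \<longrightarrow> (\<alpha>, u) \<in> \<A> \<times> \<B> \<and> even (card u + r)}"

lemma homog_induct [consumes 1, case_names zero add scale mon]:
  assumes "f \<in> homog r"
    and "P 0" "\<And>f g. P f \<Longrightarrow> P g \<Longrightarrow> P (f + g)" "\<And>c f. P f \<Longrightarrow> P (c \<bullet> f)"
    and "\<And>\<alpha> u. \<alpha> \<in> \<A> \<Longrightarrow> u \<in> \<B> \<Longrightarrow> even (card u + r) \<Longrightarrow> P (mon \<alpha> u)"
  shows "P (f :: 'a::field osup)"
proof (rule supported_induct [of "{(\<alpha>, u) \<in> \<A> \<times> \<B>. even (card u + r)}" f])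
  show "f b = 0" if "b \<notin> {(\<alpha>, u) \<in> \<A> \<times> \<B>. even (card u + r)}" for b
    using assms(1) that by (cases b) (auto simp: homog_def)
  show "P 0" by (fact assms(2))
  show "P (f + g)" if "P f" "P g" for f g using that by (rule assms(3))
  show "P (c \<bullet> f)" if "P f" for c f using that by (rule assms(4))
  show "P (mon \<alpha> u)" if "(\<alpha>, u) \<in> {(\<alpha>, u) \<in> \<A> \<times> \<B>. even (card u + r)}" for \<alpha> u
    using that by (intro assms(5)) simp_all
qed auto

lemma Oalg_induct [consumes 1, case_names zero add scale mon]:
  assumes "f \<in> \<O>"
    and "P 0" "\<And>f g. P f \<Longrightarrow> P g \<Longrightarrow> P (f + g)" "\<And>c f. P f \<Longrightarrow> P (c \<bullet> f)"
    and "\<And>\<alpha> u. \<alpha> \<in> \<A> \<Longrightarrow> u \<in> \<B> \<Longrightarrow> P (mon \<alpha> u)"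
  shows "P (f :: 'a::field osup)"
proof (rule supported_induct [of "\<A> \<times> \<B>" f])
  show "f b = 0" if "b \<notin> \<A> \<times> \<B>" for b
    using assms(1) that by (cases b) (auto simp: Oalg_def)
  show "P 0" by (fact assms(2))
  show "P (f + g)" if "P f" "P g" for f g using that by (rule assms(3))
  show "P (c \<bullet> f)" if "P f" for c f using that by (rule assms(4))
  show "P (mon \<alpha> u)" if "(\<alpha>, u) \<in> \<A> \<times> \<B>" for \<alpha> u
    using that by (intro assms(5)) simp_all
qed auto

lemma homog_mon: "\<alpha> \<in> \<A> \<Longrightarrow> u \<in> \<B> \<Longrightarrow> even (card u + r) \<Longrightarrow> mon \<alpha> u \<in> homog r"
  by (simp add: homog_def mon_apply)

lemma homog_zero [simp]: "0 \<in> homog r"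
  by (simp add: homog_def zero_fun_apply)

lemma homog_add: "f \<in> homog r \<Longrightarrow> g \<in> homog r \<Longrightarrow> f + g \<in> homog r"
proof -
  assume "f \<in> homog r" "g \<in> homog r"
  moreover have "(f + g) b \<noteq> 0 \<Longrightarrow> f b \<noteq> 0 \<or> g b \<noteq> 0" for b
    by (auto simp: plus_fun_apply)
  ultimately show ?thesis unfolding homog_def by blast
qed

lemma homog_scale: "f \<in> homog r \<Longrightarrow> c \<bullet> f \<in> homog r"
  by (auto simp: homog_def oscale_apply)

lemma homog_sum: "(\<And>k. k \<in> K \<Longrightarrow> F k \<in> homog r) \<Longrightarrow> (\<Sum>k\<in>K. F k) \<in> homog r"
  by (induction K rule: infinite_finite_induct) (simp_all add: homog_add)

lemma homog_cong: "even (r + s) \<Longrightarrow> homog r = (homog s :: 'a::field osup set)"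
proof -
  assume "even (r + s)"
  then have "even (k + r) \<longleftrightarrow> even (k + s)" for k by presburger
  then show ?thesis by (simp only: homog_def)
qed

lemma homog_subset_Oalg: "f \<in> homog r \<Longrightarrow> f \<in> \<O>"
  unfolding homog_def Oalg_def by (simp add: split_paired_all) blast

lemma homog_omul:
  assumes "f \<in> homog r" "g \<in> homog s"
  shows "f \<odot> g \<in> (homog (r + s) :: 'a::field osup set)"
  using assms(1)
proof (induction rule: homog_induct)
  case (mon \<alpha> u)
  note \<alpha> = mon
  show ?case using assms(2)
  proof (induction rule: homog_induct)
    case (mon \<beta> v)
    show ?case
    proof (cases "\<alpha> + \<beta> \<in> \<A> \<and> u \<inter> v = {}")
      case True
      have "even (card (u \<union> v) + (r + s))"
        using True \<alpha>(3) mon(3) card_Un_disjoint [of u v] finite_BB [OF \<alpha>(2)] finite_BB [OF mon(2)]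
        by presburger
      moreover have "u \<union> v \<in> \<B>" using \<alpha>(2) mon(2) by (simp add: BB_def)
      ultimately show ?thesis
        using True \<alpha> mon by (simp add: omul_mon homog_scale homog_mon)
    next
      case False
      then have "dp_coeff \<alpha> \<beta> * shuffle_sign u v = (0 :: 'a)"
        by (auto simp: dp_coeff_def shuffle_sign_def)
      then show ?thesis using \<alpha> mon by (simp add: omul_mon del: mult_eq_0_iff)
    qed
  qed (simp_all add: omul_add_right omul_scale_right homog_add homog_scale omul_right.zero)
qed (simp_all add: omul_add_left omul_scale_left homog_add homog_scale omul_left.zero)

lemma homog_der:
  assumes "f \<in> homog r" "i \<in> \<Y>"
  shows "\<partial> i f \<in> (homog (r + par m i) :: 'a::field osup set)"
  using assms(1)
proof (induction rule: homog_induct)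
  case (mon \<alpha> u)
  show ?case
  proof (cases "i \<in> Y0 m")
    case True
    with mon show ?thesis
      by (simp add: der_mon_even par_def homog_scale homog_mon AA_diff)
  next
    case False
    show ?thesis
    proof (cases "i \<in> u")
      case True
      have "even (card (u - {i}) + (r + 1))"
        using mon(3) card_Suc_Diff1 [OF finite_BB [OF mon(2)] True] by presburger
      moreover have "u - {i} \<in> \<B>" using mon(2) by (auto simp: BB_def)
      ultimately have "mon \<alpha> (u - {i}) \<in> (homog (r + 1) :: 'a osup set)"
        using mon(1) by (intro homog_mon)
      with \<open>i \<notin> Y0 m\<close> mon show ?thesis
        by (simp add: der_mon_odd par_def homog_scale)
    qed (use \<open>i \<notin> Y0 m\<close> mon in \<open>simp add: der_mon_odd removal_sign_def\<close>)
  qed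
qed (simp_all add: der_add der_scale homog_add homog_scale der.zero)

lemma Oalg_zero [simp]: "0 \<in> \<O>"
  and Oalg_add: "f \<in> \<O> \<Longrightarrow> g \<in> \<O> \<Longrightarrow> f + g \<in> \<O>"
  and Oalg_scale: "f \<in> \<O> \<Longrightarrow> c \<bullet> f \<in> \<O>"
  by (simp_all add: Oalg_def zero_fun_apply plus_fun_apply oscale_apply)

lemma Oalg_der:
  assumes "f \<in> \<O>" "i \<in> \<Y>"
  shows "\<partial> i f \<in> (\<O> :: 'a::field osup set)"
  using assms(1)
proof (induction rule: Oalg_induct)
  case (mon \<alpha> u)
  then have "mon \<alpha> u \<in> homog (card u)" by (simp add: homog_mon)
  then show ?case using assms(2) by (blast intro: homog_der homog_subset_Oalg)
qed (simp_all add: der_add der_scale Oalg_add Oalg_scale)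

lemma Oalg_omul:
  assumes "f \<in> \<O>" "g \<in> \<O>"
  shows "f \<odot> g \<in> (\<O> :: 'a::field osup set)"
  using assms(1)
proof (induction rule: Oalg_induct)
  case (mon \<alpha> u)
  then have f: "mon \<alpha> u \<in> homog (card u)" by (simp add: homog_mon)
  show ?case using assms(2)
  proof (induction rule: Oalg_induct)
    case (mon \<beta> v)
    then have "mon \<beta> v \<in> homog (card v)" by (simp add: homog_mon)
    with f show ?case by (blast intro: homog_omul homog_subset_Oalg)
  qed (simp_all add: omul_add_right omul_scale_right Oalg_add Oalg_scale)
qed (simp_all add: omul_add_left omul_scale_left Oalg_add Oalg_scale)

subsection \<open>Associativity, supercommutativity and derivatives\<close>

lemma omul_assoc:
  assumes "f \<in> \<O>" "g \<in> \<O>" "h \<in> \<O>"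
  shows "(f \<odot> g) \<odot> h = f \<odot> (g \<odot> (h :: 'a::field osup))"
  using assms(1)
proof (induction rule: Oalg_induct)
  case (mon \<alpha> u)
  note \<alpha> = mon
  show ?case using assms(2)
  proof (induction rule: Oalg_induct)
    case (mon \<beta> v)
    note \<beta> = mon
    show ?case using assms(3)
    proof (induction rule: Oalg_induct)
      case (mon \<gamma> w)
      have "dp_coeff \<alpha> \<beta> \<bullet> (mon (\<alpha> + \<beta>) (u \<union> v) \<odot> mon \<gamma> w)
          = dp_coeff \<alpha> \<beta> \<bullet> (dp_coeff (\<alpha> + \<beta>) \<gamma> * shuffle_sign (u \<union> v) w :: 'a)
            \<bullet> mon (\<alpha> + \<beta> + \<gamma>) (u \<union> v \<union> w)"
        using \<alpha> \<beta> mon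
        by (cases "\<alpha> + \<beta> \<in> \<A>") (simp add: omul_mon BB_def, simp add: dp_coeff_def)
      moreover have "(mon \<alpha> u \<odot> mon \<beta> v) \<odot> mon \<gamma> w
          = (shuffle_sign u v :: 'a) \<bullet> dp_coeff \<alpha> \<beta> \<bullet> (mon (\<alpha> + \<beta>) (u \<union> v) \<odot> mon \<gamma> w)"
        using \<alpha> \<beta> by (simp add: omul_mon omul_scale_left mult.commute)
      ultimately have l: "(mon \<alpha> u \<odot> mon \<beta> v) \<odot> mon \<gamma> w
          = ((dp_coeff \<alpha> \<beta> * dp_coeff (\<alpha> + \<beta>) \<gamma>) * (shuffle_sign u v * shuffle_sign (u \<union> v) w) :: 'a)
            \<bullet> mon (\<alpha> + \<beta> + \<gamma>) (u \<union> v \<union> w)"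
        by (simp add: mult.assoc mult.left_commute)
      have "dp_coeff \<beta> \<gamma> \<bullet> (mon \<alpha> u \<odot> mon (\<beta> + \<gamma>) (v \<union> w))
          = dp_coeff \<beta> \<gamma> \<bullet> (dp_coeff \<alpha> (\<beta> + \<gamma>) * shuffle_sign u (v \<union> w) :: 'a)
            \<bullet> mon (\<alpha> + \<beta> + \<gamma>) (u \<union> v \<union> w)"
        using \<alpha> \<beta> mon
        by (cases "\<beta> + \<gamma> \<in> \<A>") (simp add: omul_mon BB_def add.assoc Un_assoc, simp add: dp_coeff_def)
      moreover have "mon \<alpha> u \<odot> (mon \<beta> v \<odot> mon \<gamma> w)
          = (shuffle_sign v w :: 'a) \<bullet> dp_coeff \<beta> \<gamma> \<bullet> (mon \<alpha> u \<odot> mon (\<beta> + \<gamma>) (v \<union> w))"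
        using \<beta> mon by (simp add: omul_mon omul_scale_right mult.commute)
      ultimately have "mon \<alpha> u \<odot> (mon \<beta> v \<odot> mon \<gamma> w)
          = ((dp_coeff \<beta> \<gamma> * dp_coeff \<alpha> (\<beta> + \<gamma>)) * (shuffle_sign v w * shuffle_sign u (v \<union> w)) :: 'a)
            \<bullet> mon (\<alpha> + \<beta> + \<gamma>) (u \<union> v \<union> w)"
        by (simp add: mult.assoc mult.left_commute)
      with l show ?case
        using \<alpha> \<beta> mon by (simp only: dp_coeff_assoc shuffle_sign_assoc finite_BB)
    qed (simp_all add: omul_add_right omul_scale_right omul_right.zero)
  qed (simp_all add: omul_add_right omul_scale_right omul_right.zero
      omul_add_left omul_scale_left omul_left.zero)
qed (simp_all add: omul_add_left omul_scale_left omul_left.zero)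

lemma omul_supercommute:
  assumes "f \<in> homog r" "g \<in> homog s"
  shows "g \<odot> f = (- 1) ^ (r * s) \<bullet> (f \<odot> (g :: 'a::field osup))"
  using assms(1)
proof (induction rule: homog_induct)
  case (mon \<alpha> u)
  note \<alpha> = mon
  show ?case using assms(2)
  proof (induction rule: homog_induct)
    case (mon \<beta> v)
    have "even (card u * card v + r * s)"
      using \<open>even (card u + r)\<close> mon(3) by (auto simp: even_add even_mult_iff)
    then have "(- 1) ^ (card u * card v) = ((- 1) ^ (r * s) :: 'a)"
      by (rule neg_one_power_cong)
    moreover have "dp_coeff \<beta> \<alpha> = (dp_coeff \<alpha> \<beta> :: 'a)" by (rule dp_coeff_commute)
    ultimately show ?case
      using \<alpha> mon shuffle_sign_swap [of u v, where 'a = 'a]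
      by (simp add: omul_mon ac_simps)
  qed (simp_all add: omul_add_left omul_scale_left omul_left.zero omul_add_right omul_scale_right
      omul_right.zero ospace.scale_right_distrib ospace.scale_left_commute)
qed (simp_all add: omul_add_left omul_scale_left omul_left.zero omul_add_right omul_scale_right
      omul_right.zero ospace.scale_right_distrib ospace.scale_left_commute)

lemma par_Y0 [simp]: "i \<in> Y0 m \<Longrightarrow> par m i = 0"
  and par_not_Y0 [simp]: "i \<notin> Y0 m \<Longrightarrow> par m i = 1"
  by (simp_all add: par_def)

lemma YY_iff: "i \<in> \<Y> \<longleftrightarrow> i \<in> Y0 m \<or> i \<in> Y1 m n"
  by (simp add: YY_def)

lemma der_swap:
  assumes "f \<in> \<O>" "i \<in> \<Y>" "j \<in> \<Y>"
  shows "\<partial> i (\<partial> j f) = (- 1) ^ (par m i * par m j) \<bullet> \<partial> j (\<partial> i (f :: 'a::field osup))"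
  using assms(1)
proof (induction rule: Oalg_induct)
  case (mon \<alpha> u)
  have u: "u - {k} \<in> \<B>" for k using mon by (auto simp: BB_def)
  have \<alpha>: "\<alpha> - unitv k \<in> \<A>" for k using mon by (intro AA_diff)
  show ?case
  proof (cases "i = j")
    case True
    show ?thesis
    proof (cases "i \<in> Y0 m")
      case False
      with True mon u show ?thesis
        by (simp add: der_mon_odd der_scale par_def removal_sign_def)
    qed (use True in \<open>simp add: par_def\<close>)
  next
    case ij: False
    have e: "\<alpha> - unitv i - unitv j = \<alpha> - unitv j - unitv i" for i j
      by (simp add: fun_eq_iff add.commute)
    have o: "u - {i} - {j} = u - {j} - {i}" for i j by auto
    consider "i \<in> Y0 m" "j \<in> Y0 m" | "i \<in> Y0 m" "j \<notin> Y0 m" | "i \<notin> Y0 m" "j \<in> Y0 m"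
      | "i \<notin> Y0 m" "j \<notin> Y0 m" by blast
    then show ?thesis
    proof cases
      case 1
      with mon ij \<alpha> e [of i j] show ?thesis
        by (simp add: der_mon_even der_scale par_def) (simp add: unitv_def)
    next
      case 4
      then show ?thesis
        using mon ij u o [of i j] removal_sign_anticommute [of u i j, where 'a = 'a]
        by (simp add: der_mon_odd der_scale par_def mult.commute)
    qed (use mon u \<alpha> in \<open>simp_all add: der_mon_even der_mon_odd der_scale par_def\<close>)
  qed
qed (simp_all add: der_add der_scale der.zero ospace.scale_right_distrib ospace.scale_left_commute)

lemma der_omul_odd:
  assumes "f \<in> homog r" "g \<in> \<O>" "i \<in> \<Y>" "i \<notin> Y0 m"
  shows "\<partial> i (f \<odot> g) = \<partial> i f \<odot> g + (- 1) ^ r \<bullet> (f \<odot> \<partial> i (g :: 'a::field osup))"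
  using assms(1)
proof (induction rule: homog_induct)
  case (mon \<alpha> u)
  note \<alpha> = mon
  show ?case using assms(2)
  proof (induction rule: Oalg_induct)
    case (mon \<beta> v)
    have BB: "u - {i} \<in> \<B>" "v - {i} \<in> \<B>" using \<alpha> mon by (auto simp: BB_def)
    have "even (card u + r)" by (fact \<alpha>)
    then have sgn: "(- 1) ^ card u = ((- 1) ^ r :: 'a)" by (rule neg_one_power_cong)
    have L: "\<partial> i (mon \<alpha> u \<odot> mon \<beta> v) = (dp_coeff \<alpha> \<beta> * (shuffle_sign u v * removal_sign i (u \<union> v)) :: 'a)
        \<bullet> mon (\<alpha> + \<beta>) (u \<union> v - {i})"
    proof (cases "\<alpha> + \<beta> \<in> \<A>")
      case True
      have "u \<union> v \<in> \<B>" using \<alpha> mon by (auto simp: BB_def)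
      with True show ?thesis
        using \<alpha> mon assms(4) by (simp add: omul_mon der_scale der_mon_odd mult.assoc)
    next
      case False
      then have "dp_coeff \<alpha> \<beta> = (0 :: 'a)" by (simp add: dp_coeff_def)
      then show ?thesis using \<alpha> mon by (simp add: omul_mon der.zero)
    qed
    show ?case
    proof
      fix b
      show "\<partial> i (mon \<alpha> u \<odot> mon \<beta> v) b
          = (\<partial> i (mon \<alpha> u) \<odot> mon \<beta> v + (- 1) ^ r \<bullet> (mon \<alpha> u \<odot> \<partial> i (mon \<beta> v :: 'a osup))) b"
        unfolding L using \<alpha> mon BB assms(4) sgn
          arg_cong [where f = "(*) (dp_coeff \<alpha> \<beta>)",
            OF removal_sign_Leibniz [of u v i "\<lambda>w. mon (\<alpha> + \<beta>) w b :: 'a"]]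
        by (simp add: omul_mon der_mon_odd omul_scale_left omul_scale_right oscale_apply
            plus_fun_apply algebra_simps)
    qed
  qed (simp_all add: der_add der_scale der.zero omul_add_right omul_scale_right omul_right.zero
      ospace.scale_right_distrib ospace.scale_left_commute algebra_simps)
qed (simp_all add: der_add der_scale der.zero omul_add_left omul_scale_left omul_left.zero
      ospace.scale_right_distrib ospace.scale_left_commute algebra_simps)

subsection \<open>Powers of an even derivative\<close>

lemma Oalg_der_funpow: "f \<in> \<O> \<Longrightarrow> i \<in> \<Y> \<Longrightarrow> (\<partial> i ^^ N) f \<in> \<O>"
  by (induction N) (simp_all add: Oalg_der)

lemma der_funpow_add: "(\<partial> i ^^ N) (f + g) = (\<partial> i ^^ N) f + (\<partial> i ^^ N) (g :: 'a::field osup)"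
  by (induction N) (simp_all add: der_add)

lemma der_funpow_scale: "(\<partial> i ^^ N) (c \<bullet> f) = c \<bullet> (\<partial> i ^^ N) (f :: 'a::field osup)"
  by (induction N) (simp_all add: der_scale)

lemma der_funpow_zero: "(\<partial> i ^^ N) 0 = (0 :: 'a::field osup)"
  by (induction N) simp_all

lemma der_funpow_sum:
  "(\<partial> i ^^ N) (\<Sum>k\<in>K. F k) = (\<Sum>k\<in>K. (\<partial> i ^^ N) (F k :: 'a::field osup))"
  by (induction K rule: infinite_finite_induct) (simp_all add: der_funpow_zero der_funpow_add)

lemma homog_der_funpow:
  assumes "f \<in> homog r" "i \<in> Y0 m"
  shows "(\<partial> i ^^ N) f \<in> (homog r :: 'a::field osup set)"
proof (induction N)
  case (Suc N)
  then show ?case using homog_der [OF Suc, of i] assms(2) by (simp add: YY_iff)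
qed (simp add: assms)

lemma der_funpow_commute:
  assumes "f \<in> \<O>" "i \<in> Y0 m" "j \<in> \<Y>"
  shows "(\<partial> i ^^ N) (\<partial> j f) = \<partial> j ((\<partial> i ^^ N) (f :: 'a::field osup))"
proof (induction N)
  case (Suc N)
  have i: "i \<in> \<Y>" using assms(2) by (simp add: YY_iff)
  have "\<partial> i (\<partial> j ((\<partial> i ^^ N) f)) = \<partial> j (\<partial> i ((\<partial> i ^^ N) f))"
    using der_swap [OF Oalg_der_funpow [OF assms(1) i] i assms(3), of N] assms(2) by simp
  then show ?case using Suc by simp
qed simp

section \<open>Hamiltonian superderivations and the Poisson bracket\<close>

lemma hpart_eq_self_iff:
  assumes "r < 2"
  shows "f \<in> \<O> \<and> hpart r f = f \<longleftrightarrow> f \<in> (homog r :: 'a::field osup set)"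
proof -
  have "card u mod 2 = r \<longleftrightarrow> even (card u + r)" for u :: "nat set"
    using assms by presburger
  then show ?thesis
    by (auto simp: homog_def Oalg_def hpart_def fun_eq_iff)
qed

lemma hpart_homog:
  assumes "f \<in> homog r" "r < 2" "s < 2"
  shows "hpart s f = (if s = r then f else (0 :: 'a::field osup))"
proof -
  have f: "hpart r f = f" using hpart_eq_self_iff [OF assms(2), of f] assms(1) by blast
  show ?thesis
  proof (cases "s = r")
    case False
    have "hpart s (hpart r f) = 0"
      using False by (auto simp: hpart_def fun_eq_iff zero_fun_apply)
    with f False show ?thesis by simp
  qed (simp add: f)
qed

lemma par_less_2 [simp]: "par m i < 2"
  by (simp add: par_def)

lemma Weven_iff:
  "A \<in> Weven p m n t \<longleftrightarrow> (\<forall>i. if i \<in> \<Y> then A i \<in> (homog (par m i) :: 'a::field osup set) else A i = 0)"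
proof -
  have "A i \<in> homog (par m i) \<longleftrightarrow> A i \<in> \<O> \<and> hpart (par m i) (A i) = A i" for i
    by (rule hpart_eq_self_iff [OF par_less_2, symmetric])
  then show ?thesis unfolding Weven_def Wsup_def by auto
qed

text \<open>
  A superderivation, given by its coefficient family, as an operator on the algebra.
\<close>

definition act :: "'a::field wsup \<Rightarrow> 'a osup \<Rightarrow> 'a osup" where
  "act A f = (\<Sum>i\<in>\<Y>. A i \<odot> \<partial> i f)"

lemma act_zero [simp]: "act A 0 = 0"
  by (simp add: act_def)

lemma act_scale: "act A (c \<bullet> f) = c \<bullet> act A f"
  by (simp add: act_def der_scale omul_scale_right ospace.scale_sum_right)

text \<open>
  The coefficient of \<open>\<partial>_i\<close> in an even superderivation has the parity of \<open>\<partial>_i\<close>.  So of the summands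
  that define the bracket only one per pair of indices survives, and it carries no sign.
\<close>

lemma bracket_even:
  assumes "A \<in> (Weven p m n t :: 'a::field wsup set)" "B \<in> Weven p m n t"
  shows "bracket p m n t A B k = act A (B k) - act B (A k)"
proof -
  have A: "A i \<in> homog (par m i)" and B: "B i \<in> homog (par m i)" if "i \<in> \<Y>" for i
    using assms that by (auto simp: Weven_iff)
  have hb: "(\<Sum>r\<in>{0, 1}. \<Sum>s\<in>{0, 1}. hbracket p m n t r (hpart r (A i)) i s (hpart s (B j)) j) k
      = (if k = j then A i \<odot> \<partial> i (B k) else 0) - (if k = i then B j \<odot> \<partial> j (A k) else 0)"
    if ij: "i \<in> \<Y>" "j \<in> \<Y>" for i j
  proof -
    have z: "hbracket p m n t r 0 i s b j = 0" "hbracket p m n t r a i s 0 j = 0" for r s and a b :: "'a osup"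
      by (simp_all add: hbracket_def elt_def wscale_def fun_eq_iff zero_fun_apply oscale_apply)
    have "hbracket p m n t r (hpart r (A i)) i s (hpart s (B j)) j
        = (if r = par m i \<and> s = par m j then hbracket p m n t r (A i) i s (B j) j else 0)"
      if "r \<in> {0, 1}" "s \<in> {0, 1}" for r s
    proof -
      have "r < 2" "s < 2" using that by auto
      then show ?thesis
        using hpart_homog [OF A [OF ij(1)] par_less_2, of r] hpart_homog [OF B [OF ij(2)] par_less_2, of s]
        by (simp add: z)
    qed
    then have "(\<Sum>r\<in>{0, 1}. \<Sum>s\<in>{0, 1}. hbracket p m n t r (hpart r (A i)) i s (hpart s (B j)) j)
        = hbracket p m n t (par m i) (A i) i (par m j) (B j) j"
      by (simp add: par_def)
    then show ?thesis
      by (auto simp: hbracket_def elt_def wscale_def)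
  qed
  have "bracket p m n t A B k = (\<Sum>i\<in>\<Y>. \<Sum>j\<in>\<Y>.
      (if k = j then A i \<odot> \<partial> i (B k) else 0) - (if k = i then B j \<odot> \<partial> j (A k) else 0))"
    unfolding bracket_def osum_apply [where k = k and S = "\<Y>"] using hb by (intro sum.cong refl) blast
  also have "\<dots> = (if k \<in> \<Y> then act A (B k) - act B (A k) else 0)"
  proof -
    have "(\<Sum>i\<in>\<Y>. \<Sum>j\<in>\<Y>. if k = i then B j \<odot> \<partial> j (A k) else 0)
        = (\<Sum>i\<in>\<Y>. if k = i then act B (A k) else 0)"
      by (intro sum.cong) (auto simp: act_def)
    then show ?thesis
      by (simp add: sum_subtractf act_def)
  qed
  finally show ?thesis
    using assms by (auto simp: Weven_iff)
qed

subsection \<open>The conjugation of indices\<close>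

lemma prm_in [simp]: "i \<in> \<Y> \<Longrightarrow> prm m i \<in> \<Y>"
  and prm_prm [simp]: "i \<in> \<Y> \<Longrightarrow> prm m (prm m i) = i"
  and par_prm [simp]: "i \<in> \<Y> \<Longrightarrow> par m (prm m i) = par m i"
  by (auto simp: prm_def YY_def Y0_def Y1_def par_def)

lemma prm_Y1: "i \<in> Y1 m n \<Longrightarrow> prm m i = i"
  by (auto simp: prm_def Y1_def)

lemma tau_prm: "i \<in> \<Y> \<Longrightarrow> tau m (prm m i) = (- ((- 1) ^ par m i * tau m i) :: 'a::field)"
  by (auto simp: prm_def YY_def Y0_def Y1_def par_def tau_def)

lemma sum_prm: "(\<Sum>k\<in>\<Y>. F (prm m k)) = (\<Sum>k\<in>\<Y>. F k)"
  by (rule sum.reindex_bij_witness [of _ "prm m" "prm m"]) simp_all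

text \<open>
  The super skew symmetry of the form \<open>\<Sum>k. \<tau>(k') \<partial>_k' \<otimes> \<partial>_k\<close>.  It is responsible for the skew symmetry of
  the Poisson bracket, for its compatibility with derivatives, and for the vanishing of the
  second-order operator \<open>\<Sum>k. \<tau>(k') \<partial>_k' \<partial>_k\<close>.
\<close>

lemma tau_prm_reindex:
  "(\<Sum>k\<in>\<Y>. ((- 1) ^ par m k * tau m (prm m k)) \<bullet> F k) = - (\<Sum>k\<in>\<Y>. tau m (prm m k) \<bullet> (F (prm m k) :: 'a::field osup))"
proof -
  have "(\<Sum>k\<in>\<Y>. ((- 1) ^ par m k * tau m (prm m k)) \<bullet> F k)
      = (\<Sum>k\<in>\<Y>. ((- 1) ^ par m (prm m k) * tau m (prm m (prm m k))) \<bullet> F (prm m k))"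
    by (rule sum_prm [symmetric])
  also have "\<dots> = (\<Sum>k\<in>\<Y>. - (tau m (prm m k) \<bullet> F (prm m k)))"
    by (rule sum.cong) (simp_all add: tau_prm ospace.scale_minus_left)
  finally show ?thesis by (simp add: sum_negf)
qed

subsection \<open>The map D_H\<close>

lemma linear_DH: "Vector_Spaces.linear oscale wscale (DH p m n t :: 'a::field osup \<Rightarrow> 'a wsup)"
proof -
  have h: "hpart r (f + g) = hpart r f + hpart r g" "hpart r (c \<bullet> f) = c \<bullet> hpart r f" for r c and f g :: "'a osup"
    by (auto simp: hpart_def fun_eq_iff plus_fun_apply oscale_apply)
  have e: "elt (f + g) i = elt f i + elt g i" "elt (c \<bullet> f) i = wscale c (elt f i)" for i c and f g :: "'a osup"
    by (auto simp: elt_def fun_eq_iff plus_fun_apply zero_fun_apply oscale_apply wscale_def)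
  show ?thesis
    by unfold_locales (simp_all add: DH_def h der_add der_scale e wspace.scale_right_distrib sum.distrib
        wspace.scale_sum_right ac_simps)
qed

interpretation DH: Vector_Spaces.linear oscale wscale "DH p m n t :: 'a::field osup \<Rightarrow> 'a wsup"
  by (rule linear_DH)

lemma DH_even:
  assumes "f \<in> homog 0"
  shows "DH p m n t f k = (if k \<in> \<Y> then tau m (prm m k) \<bullet> \<partial> (prm m k) f else (0 :: 'a::field osup))"
proof -
  have "DH p m n t f k = (\<Sum>i\<in>\<Y>. (tau m i \<bullet> elt (\<partial> i f) (prm m i) k))"
    using hpart_homog [OF assms, of 0] hpart_homog [OF assms, of 1]
    by (simp add: DH_def osum_apply [where k = k] plus_fun_apply [of _ _ k] wscale_def elt_def
        zero_fun_apply if_distrib cong: if_cong)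
  also have "\<dots> = (\<Sum>i\<in>\<Y>. if i = prm m k \<and> k \<in> \<Y> then tau m i \<bullet> \<partial> i f else 0)"
  proof (rule sum.cong)
    fix i assume "i \<in> \<Y>"
    then have "k = prm m i \<longleftrightarrow> i = prm m k \<and> k \<in> \<Y>" by auto
    then show "tau m i \<bullet> elt (\<partial> i f) (prm m i) k = (if i = prm m k \<and> k \<in> \<Y> then tau m i \<bullet> \<partial> i f else 0)"
      by (simp add: elt_def)
  qed simp
  also have "\<dots> = (if k \<in> \<Y> then tau m (prm m k) \<bullet> \<partial> (prm m k) f else 0)"
    by simp
  finally show ?thesis .
qed

lemma DH_Weven:
  assumes "f \<in> homog 0"
  shows "DH p m n t f \<in> (Weven p m n t :: 'a::field wsup set)"
  unfolding Weven_iff DH_even [OF assms]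
  using homog_der [OF assms] by (auto intro!: homog_scale) (metis add_0 par_prm prm_in)

lemma HH_eq: "HH p m n t = DH p m n t ` (Hpre p m n t :: 'a::field osup set)"
  unfolding HH_def Hpre_def DH.span_image [symmetric] by (simp add: image_image case_prod_beta')

subsection \<open>The Poisson bracket\<close>

definition poisson :: "'a::field osup \<Rightarrow> 'a osup \<Rightarrow> 'a osup" where
  "poisson f g = (\<Sum>k\<in>\<Y>. tau m (prm m k) \<bullet> (\<partial> (prm m k) f \<odot> \<partial> k g))"

lemma act_DH: "f \<in> (homog 0 :: 'a::field osup set) \<Longrightarrow> act (DH p m n t f) g = poisson f g"
  by (simp add: act_def poisson_def DH_even omul_scale_left)

lemma homog_der_prm: "f \<in> homog r \<Longrightarrow> k \<in> \<Y> \<Longrightarrow> \<partial> (prm m k) f \<in> (homog (r + par m k) :: 'a::field osup set)"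
  using homog_der [of f r "prm m k"] by simp

lemma poisson_even:
  assumes "f \<in> (homog 0 :: 'a::field osup set)" "g \<in> homog 0"
  shows "poisson f g \<in> homog 0"
  unfolding poisson_def
proof (intro homog_sum homog_scale)
  fix k assume k: "k \<in> \<Y>"
  have "\<partial> (prm m k) f \<odot> \<partial> k g \<in> homog ((0 + par m k) + (0 + par m k))"
    using homog_der_prm [OF assms(1) k] homog_der [OF assms(2) k] by (rule homog_omul)
  moreover have "homog ((0 + par m k) + (0 + par m k)) = (homog 0 :: 'a osup set)"
    by (rule homog_cong) simp
  ultimately show "\<partial> (prm m k) f \<odot> \<partial> k g \<in> homog 0" by simp
qed

lemma poisson_skew:
  assumes "f \<in> (homog 0 :: 'a::field osup set)" "g \<in> homog 0"
  shows "poisson g f = - poisson f g"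
proof -
  have "\<partial> (prm m k) g \<odot> \<partial> k f = (- 1) ^ par m k \<bullet> (\<partial> k f \<odot> \<partial> (prm m k) g)" if "k \<in> \<Y>" for k
    using omul_supercommute [OF homog_der [OF assms(1) that] homog_der_prm [OF assms(2) that]]
    by (simp add: par_def split: if_splits)
  then have "poisson g f = (\<Sum>k\<in>\<Y>. ((- 1) ^ par m k * tau m (prm m k)) \<bullet> (\<partial> k f \<odot> \<partial> (prm m k) g))"
    by (simp add: poisson_def mult.commute)
  also have "\<dots> = - poisson f g"
    unfolding poisson_def by (simp add: tau_prm_reindex)
  finally show ?thesis .
qed

text \<open>
  Only odd derivatives of \<open>x^\<omega>\<close> are nonzero.  An even \<open>x^u\<close> with \<open>k \<in> u\<close> has a further index \<open>l\<close> besides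
  \<open>k\<close>, and \<open>x_l\<close> occurs in \<open>\<partial>_k x^u\<close> as well as in \<open>\<partial>_k x^\<omega>\<close>.
\<close>

lemma poisson_top_monomial:
  assumes "even n" and f: "f \<in> (homog 0 :: 'a::field osup set)"
  shows "poisson f (mon 0 (Y1 m n)) = 0"
proof -
  have basis: "(0, Y1 m n) \<in> \<A> \<times> \<B>" by (simp add: AA_def BB_def zero_fun_apply)
  have "\<partial> (prm m k) f \<odot> \<partial> k (mon 0 (Y1 m n)) = (0 :: 'a osup)" if k: "k \<in> \<Y>" for k
  proof (cases "k \<in> Y0 m")
    case True
    then show ?thesis using basis by (simp add: der_mon_even zero_fun_apply)
  next
    case False
    then have k1: "k \<in> Y1 m n" using k by (simp add: YY_iff)
    have "\<partial> k f \<odot> \<partial> k (mon 0 (Y1 m n)) = 0" using f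
    proof (induction rule: homog_induct)
      case (mon \<alpha> u)
      have "shuffle_sign (u - {k}) (Y1 m n - {k}) = (0 :: 'a)" if "k \<in> u"
      proof -
        have "card (u - {k}) \<noteq> 0"
          using mon(3) card_Suc_Diff1 [OF finite_BB [OF mon(2)] that] by presburger
        then have "u - {k} \<noteq> {}" by (metis card.empty)
        then obtain l where "l \<in> u - {k}" by blast
        then show ?thesis using mon(2) by (auto simp: shuffle_sign_def BB_def)
      qed
      moreover have "(\<alpha>, u - {k}) \<in> \<A> \<times> \<B>" "(0, Y1 m n - {k}) \<in> \<A> \<times> \<B>"
        using mon basis by (auto simp: BB_def)
      ultimately show ?case
        using mon basis False by (cases "k \<in> u")
          (simp_all add: der_mon_odd omul_scale_left omul_scale_right omul_mon,
           simp_all add: removal_sign_def)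
    qed (simp_all add: der_add der_scale omul_add_left omul_scale_left)
    then show ?thesis by (simp add: prm_Y1 [OF k1])
  qed
  then show ?thesis by (simp add: poisson_def)
qed

subsection \<open>The top monomial\<close>

text \<open>
  The monomial \<open>x^(\<pi>) x^\<omega>\<close> is maximal in every variable, hence is not a term of any derivative.
\<close>

lemma der_top_coefficient:
  assumes "f \<in> \<O>" "i \<in> \<Y>"
  shows "\<partial> i f (\<pi>, Y1 m n) = (0 :: 'a::field)"
  using assms(1)
proof (induction rule: Oalg_induct)
  case (mon \<alpha> u)
  show ?case
  proof (cases "i \<in> Y0 m")
    case True
    have "\<alpha> - unitv i \<noteq> \<pi>" if "\<alpha> i \<noteq> 0"
    proof
      assume "\<alpha> - unitv i = \<pi>"
      then have "(\<alpha> - unitv i) i = \<pi> i" by simp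
      then have "\<alpha> i - 1 = \<pi> i" by (simp add: unitv_def)
      with that True mon(1) show False by (fastforce simp: AA_def)
    qed
    then have "(if \<alpha> i = 0 then 0 else 1) * mon (\<alpha> - unitv i) u (\<pi>, Y1 m n) = (0 :: 'a)"
      by (auto simp: mon_apply)
    with mon True show ?thesis by (simp add: der_mon_even oscale_apply)
  next
    case False
    then have "i \<in> Y1 m n" using assms(2) by (simp add: YY_iff)
    then have "Y1 m n \<noteq> u - {i}" by blast
    then have "mon \<alpha> (u - {i}) (\<pi>, Y1 m n) = (0 :: 'a)" by (simp add: mon_apply)
    with mon False show ?thesis by (simp add: der_mon_odd oscale_apply)
  qed
qed (simp_all only: der_add der_scale der.zero, simp_all add: zero_fun_apply plus_fun_apply oscale_apply)

lemma mon_in_Hpre: "(\<alpha>, u) \<in> Hidx p m n t \<Longrightarrow> mon \<alpha> u \<in> (Hpre p m n t :: 'a::field osup set)"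
  unfolding Hpre_def by (rule ospace.span_base) (force simp: image_iff)

lemma Hpre_iff: "f \<in> Hpre p m n t \<longleftrightarrow> f \<in> homog 0 \<and> f (\<pi>, Y1 m n) = (0 :: 'a::field)"
proof
  assume "f \<in> Hpre p m n t"
  then show "f \<in> homog 0 \<and> f (\<pi>, Y1 m n) = 0"
    unfolding Hpre_def
  proof (induction rule: ospace.span_induct_alt)
    case base
    have "(0 :: 'a osup) \<in> homog 0" "(0 :: 'a osup) (\<pi>, Y1 m n) = 0"
      by (rule homog_zero) (simp add: zero_fun_apply)
    then show ?case by blast
  next
    case (step c x y)
    then obtain \<alpha> u where x: "x = mon \<alpha> u" and au: "(\<alpha>, u) \<in> Hidx p m n t" by auto
    have "x \<in> homog 0"
      unfolding x using au by (intro homog_mon) (simp_all add: Hidx_def BB0_def)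
    moreover have "x (\<pi>, Y1 m n) = 0"
      using au unfolding x by (auto simp: Hidx_def mon_apply)
    ultimately have "c \<bullet> x + y \<in> homog 0" "(c \<bullet> x + y) (\<pi>, Y1 m n) = 0"
      using step by (simp_all only: homog_add homog_scale) (simp add: plus_fun_apply oscale_apply)
    then show ?case by simp
  qed
next
  assume f: "f \<in> homog 0 \<and> f (\<pi>, Y1 m n) = 0"
  show "f \<in> Hpre p m n t"
  proof (rule supported_induct [of "Hidx p m n t" f])
    show "Hidx p m n t \<subseteq> \<A> \<times> \<B>" by (auto simp: Hidx_def BB0_def)
    show "f b = 0" if "b \<notin> Hidx p m n t" for b
      using f that by (cases b) (auto simp: Hidx_def BB0_def homog_def)
  qed (auto simp: Hpre_def intro: ospace.span_add ospace.span_scale mon_in_Hpre [unfolded Hpre_def] ospace.span_zero)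
qed

text \<open>
  The derivatives \<open>\<partial>_k'\<close> and \<open>\<partial>_k\<close> supercommute while \<open>\<Sum>k. \<tau>(k') \<partial>_k' \<otimes> \<partial>_k\<close> is super skew
  symmetric, so the sum is its own negative.
\<close>

lemma Laplacian_zero:
  assumes two: "(2 :: 'a::field) \<noteq> 0" and g: "g \<in> \<O>"
  shows "(\<Sum>k\<in>\<Y>. tau m (prm m k) \<bullet> \<partial> (prm m k) (\<partial> k g)) = (0 :: 'a osup)" (is "?L = 0")
proof -
  have "?L = (\<Sum>k\<in>\<Y>. ((- 1) ^ par m k * tau m (prm m k)) \<bullet> \<partial> k (\<partial> (prm m k) g))"
  proof (rule sum.cong)
    fix k assume k: "k \<in> \<Y>"
    show "tau m (prm m k) \<bullet> \<partial> (prm m k) (\<partial> k g)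
        = ((- 1) ^ par m k * tau m (prm m k)) \<bullet> \<partial> k (\<partial> (prm m k) g)"
      using der_swap [OF g prm_in [OF k] k] k by (cases "k \<in> Y0 m") (simp_all add: mult.commute)
  qed simp
  also have "\<dots> = - (\<Sum>k\<in>\<Y>. tau m (prm m k) \<bullet> \<partial> (prm m k) (\<partial> (prm m (prm m k)) g))"
    using tau_prm_reindex [of "\<lambda>k. \<partial> k (\<partial> (prm m k) g)"] .
  also have "\<dots> = - ?L" by simp
  finally have "?L + ?L = 0" by (simp add: eq_neg_iff_add_eq_0)
  then have "2 \<bullet> ?L = 0"
    using ospace.scale_left_distrib [of 1 1 ?L] by simp
  then show ?thesis using two by simp
qed

subsection \<open>Multiples of a Hamiltonian superderivation\<close>

lemma wact_add: "wact p m n t (f + g) A = wact p m n t f A + wact p m n t g (A :: 'a::field wsup)"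
  and wact_diff: "wact p m n t (f - g) A = wact p m n t f A - wact p m n t g (A :: 'a wsup)"
  and wact_scale: "wact p m n t (c \<bullet> f) A = wscale c (wact p m n t f A)"
  by (rule ext, simp add: wact_def plus_fun_apply omul_add_left omul_left.diff omul_scale_left wscale_def)+

lemma wact_DH_Weven:
  assumes "g \<in> homog 0" "h \<in> homog 0"
  shows "wact p m n t g (DH p m n t h) \<in> (Weven p m n t :: 'a::field wsup set)"
  using DH_Weven [OF assms(2)] homog_omul [OF assms(1)]
  by (fastforce simp: Weven_iff wact_def)

section \<open>The Leibniz rule in characteristic p\<close>

text \<open>
  If \<open>p\<close> did not divide the binomial coefficient, then \<open>k (p^e choose k) = p^e (p^e - 1 choose k - 1)\<close>
  would force \<open>p^e\<close> to divide \<open>k\<close>.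
\<close>

lemma prime_dvd_prime_power_choose:
  assumes "prime (p::nat)" "0 < k" "k < p ^ e"
  shows "p dvd (p ^ e choose k)"
proof (rule ccontr)
  assume "\<not> p dvd (p ^ e choose k)"
  then have "coprime (p ^ e) (p ^ e choose k)"
    using prime_imp_coprime [OF assms(1)] by (simp add: coprime_power_left_iff)
  moreover have "p ^ e dvd k * (p ^ e choose k)"
    by (simp only: times_binomial_minus1_eq [OF assms(2)] dvd_triv_left)
  ultimately have "p ^ e dvd k" by (simp add: coprime_dvd_mult_left_iff)
  then show False using assms by (auto dest: dvd_imp_le)
qed

lemma of_nat_prime_power_choose:
  assumes "prime p" "of_nat p = (0::'a::field)" "0 < k" "k < p ^ e"
  shows "of_nat (p ^ e choose k) = (0::'a)"
proof -
  obtain c where "(p ^ e choose k) = p * c"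
    using prime_dvd_prime_power_choose assms by blast
  then show ?thesis using assms(2) by simp
qed

text \<open>
  Isolates the exponents at \<open>i\<close>: the remaining factor is common to the three terms of the Leibniz rule
  for \<open>\<partial>_i\<close>.
\<close>

lemma dp_coeff_fun_upd:
  assumes "\<alpha> \<in> \<A>" "\<beta> \<in> \<A>" "i \<in> Y0 m"
  shows "dp_coeff (\<alpha>(i := a)) (\<beta>(i := b))
    = (if \<forall>j\<in>Y0 m - {i}. \<alpha> j + \<beta> j \<le> \<pi> j
       then of_nat (\<Prod>j\<in>Y0 m - {i}. (\<alpha> j + \<beta> j) choose \<alpha> j)
            * (if a + b \<le> \<pi> i then of_nat ((a + b) choose a) else 0)
       else (0 :: 'a::field))"
proof -
  have "\<alpha>(i := a) + \<beta>(i := b) \<in> \<A> \<longleftrightarrow> (\<forall>j\<in>Y0 m - {i}. \<alpha> j + \<beta> j \<le> \<pi> j) \<and> a + b \<le> \<pi> i"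
    using assms by (auto simp: AA_def plus_fun_apply)
  moreover have "(\<Prod>j\<in>Y0 m. ((\<alpha>(i := a)) j + (\<beta>(i := b)) j) choose (\<alpha>(i := a)) j)
      = ((a + b) choose a) * (\<Prod>j\<in>Y0 m - {i}. (\<alpha> j + \<beta> j) choose \<alpha> j)"
    using assms(3) by (subst prod.remove [of _ i]) (auto intro!: prod.cong)
  ultimately show ?thesis
    unfolding dp_coeff_def by (simp del: of_nat_prod add: mult.commute)
qed

context
  assumes prime: "prime p" and char: "of_nat p = (0 :: 'a::field)"
begin

text \<open>
  Here \<open>K a b\<close> is the coefficient of the product of the divided powers \<open>a\<close> and \<open>b\<close> of one variable, so
  that Pascal's rule is the Leibniz rule.  Truncation could only harm it at \<open>a + b = p^e\<close>, where the
  product is cut off but its derivative is not.  There both terms on the right survive, and they add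
  up to \<open>p^e choose a\<close>, which is zero in characteristic \<open>p\<close>.
\<close>

lemma truncated_Pascal:
  assumes "a < p ^ e" "b < p ^ e"
  defines "K \<equiv> \<lambda>a b. if a + b < p ^ e then of_nat ((a + b) choose a) else (0 :: 'a)"
  shows "(if a + b = 0 then 0 else K a b)
    = (if a = 0 then 0 else K (a - 1) b) + (if b = 0 then 0 else K a (b - 1))"
proof (cases "a = 0 \<or> b = 0")
  case False
  then obtain a' b' where ab: "a = Suc a'" "b = Suc b'" by (auto simp: gr0_conv_Suc)
  have Pascal: "of_nat ((a + b) choose a)
      = (of_nat ((a' + b) choose a') + of_nat ((a + b') choose a) :: 'a)"
    unfolding ab by simp
  consider "a + b < p ^ e" | "a + b = p ^ e" | "a + b > p ^ e" by linarith
  then show ?thesis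
  proof cases
    case 1
    then show ?thesis using ab Pascal by (simp add: K_def)
  next
    case 2
    then have "of_nat ((a + b) choose a) = (0 :: 'a)"
      using of_nat_prime_power_choose [OF prime char, of a e] assms(1) ab by simp
    moreover have "a' + b < p ^ e" "a + b' < p ^ e" using 2 ab by linarith+
    ultimately show ?thesis using 2 ab Pascal by (simp add: K_def)
  next
    case 3
    then show ?thesis using ab by (simp add: K_def)
  qed
qed (use assms in \<open>auto simp: K_def\<close>)

text \<open>
  The Leibniz rule of \<open>\<partial>_i\<close> on divided powers; as in \<open>removal_sign_Leibniz\<close>, the function \<open>M\<close> stands for
  the resulting monomials.
\<close>

lemma dp_coeff_Leibniz:
  fixes M :: "(nat \<Rightarrow> nat) \<Rightarrow> 'a"
  assumes \<alpha>: "\<alpha> \<in> \<A>" and \<beta>: "\<beta> \<in> \<A>" and i: "i \<in> Y0 m"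
  shows "dp_coeff \<alpha> \<beta> * (if (\<alpha> + \<beta>) i = 0 then 0 else 1) * M (\<alpha> + \<beta> - unitv i)
    = (if \<alpha> i = 0 then 0 else 1) * dp_coeff (\<alpha> - unitv i) \<beta> * M (\<alpha> - unitv i + \<beta>)
      + (if \<beta> i = 0 then 0 else 1) * dp_coeff \<alpha> (\<beta> - unitv i) * M (\<alpha> + (\<beta> - unitv i))"
proof -
  have diff: "\<gamma> - unitv i = \<gamma>(i := \<gamma> i - 1)" for \<gamma>
    by (auto simp: unitv_def)
  have M: "\<alpha> i \<noteq> 0 \<Longrightarrow> \<alpha> - unitv i + \<beta> = \<alpha> + \<beta> - unitv i"
    "\<beta> i \<noteq> 0 \<Longrightarrow> \<alpha> + (\<beta> - unitv i) = \<alpha> + \<beta> - unitv i"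
    by (auto simp: unitv_def plus_fun_apply fun_eq_iff)
  have le: "c \<le> \<pi> i \<longleftrightarrow> c < p ^ t i" for c
    using i prime_gt_0_nat [OF prime] by (auto simp: ppi_def less_Suc_eq_le [symmetric])
  have "\<alpha> i < p ^ t i" "\<beta> i < p ^ t i"
    using \<alpha> \<beta> i by (auto simp: AA_def le [symmetric])
  note Pascal = truncated_Pascal [OF this]
  define C :: 'a where "C = (if \<forall>j\<in>Y0 m - {i}. \<alpha> j + \<beta> j \<le> \<pi> j
       then of_nat (\<Prod>j\<in>Y0 m - {i}. (\<alpha> j + \<beta> j) choose \<alpha> j) else 0)"
  have dp: "dp_coeff (\<alpha>(i := a)) (\<beta>(i := b))
      = C * (if a + b < p ^ t i then of_nat ((a + b) choose a) else 0)" for a b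
    unfolding dp_coeff_fun_upd [OF \<alpha> \<beta> i] le by (simp add: C_def del: of_nat_prod)
  have "dp_coeff \<alpha> \<beta> * (if \<alpha> i + \<beta> i = 0 then 0 else 1)
      = C * (if \<alpha> i + \<beta> i = 0 then 0
             else if \<alpha> i + \<beta> i < p ^ t i then of_nat ((\<alpha> i + \<beta> i) choose \<alpha> i) else 0)"
    using dp [of "\<alpha> i" "\<beta> i"] by simp
  also have "\<dots> = (if \<alpha> i = 0 then 0 else 1) * dp_coeff (\<alpha> - unitv i) \<beta>
      + (if \<beta> i = 0 then 0 else 1) * dp_coeff \<alpha> (\<beta> - unitv i)"
    unfolding Pascal diff using dp [of "\<alpha> i - 1" "\<beta> i"] dp [of "\<alpha> i" "\<beta> i - 1"]
    by (simp add: distrib_left)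
  finally show ?thesis
    using M by (simp add: plus_fun_apply distrib_right split: if_splits)
qed

lemma der_omul_even:
  assumes "f \<in> \<O>" "g \<in> \<O>" "i \<in> Y0 m"
  shows "\<partial> i (f \<odot> g) = \<partial> i f \<odot> g + f \<odot> \<partial> i (g :: 'a osup)"
  using assms(1)
proof (induction rule: Oalg_induct)
  case (mon \<alpha> u)
  note \<alpha> = mon
  show ?case using assms(2)
  proof (induction rule: Oalg_induct)
    case (mon \<beta> v)
    have AA: "\<alpha> - unitv i \<in> \<A>" "\<beta> - unitv i \<in> \<A>" using \<alpha> mon by (auto intro: AA_diff)
    have L: "\<partial> i (mon \<alpha> u \<odot> mon \<beta> v)
        = (shuffle_sign u v * (dp_coeff \<alpha> \<beta> * (if (\<alpha> + \<beta>) i = 0 then 0 else 1)) :: 'a)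
        \<bullet> mon (\<alpha> + \<beta> - unitv i) (u \<union> v)"
    proof (cases "\<alpha> + \<beta> \<in> \<A>")
      case True
      have "u \<union> v \<in> \<B>" using \<alpha> mon by (auto simp: BB_def)
      with True show ?thesis
        using \<alpha> mon assms(3) by (simp add: omul_mon der_scale der_mon_even)
    next
      case False
      then have "dp_coeff \<alpha> \<beta> = (0 :: 'a)" by (simp add: dp_coeff_def)
      then show ?thesis using \<alpha> mon by (simp add: omul_mon)
    qed
    show ?case
    proof
      fix b
      show "\<partial> i (mon \<alpha> u \<odot> mon \<beta> v) b
          = (\<partial> i (mon \<alpha> u) \<odot> mon \<beta> v + mon \<alpha> u \<odot> \<partial> i (mon \<beta> v :: 'a osup)) b"
        unfolding L using \<alpha> mon AA assms(3)
          arg_cong [where f = "(*) (shuffle_sign u v)",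
            OF dp_coeff_Leibniz [of \<alpha> \<beta> i "\<lambda>w. mon w (u \<union> v) b :: 'a"]]
        by (simp only: omul_mon der_mon_even omul_scale_left omul_scale_right oscale_apply
            plus_fun_apply mem_Sigma_iff simp_thms) (simp add: algebra_simps)
    qed
  qed (simp_all add: der_add der_scale omul_add_right omul_scale_right
      ospace.scale_right_distrib ospace.scale_left_commute algebra_simps)
qed (simp_all add: der_add der_scale omul_add_left omul_scale_left
      ospace.scale_right_distrib ospace.scale_left_commute algebra_simps)

lemma der_omul:
  assumes "f \<in> homog r" "g \<in> \<O>" "i \<in> \<Y>"
  shows "\<partial> i (f \<odot> g) = \<partial> i f \<odot> g + (- 1) ^ (par m i * r) \<bullet> (f \<odot> \<partial> i (g :: 'a osup))"
proof (cases "i \<in> Y0 m")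
  case True
  then show ?thesis using der_omul_even [OF homog_subset_Oalg [OF assms(1)] assms(2)] by simp
next
  case False
  then show ?thesis using der_omul_odd [OF assms] by simp
qed

lemma der_funpow_omul:
  assumes "f \<in> \<O>" "g \<in> \<O>" "i \<in> Y0 m"
  shows "(\<partial> i ^^ N) (f \<odot> g)
    = (\<Sum>k\<le>N. of_nat (N choose k) \<bullet> ((\<partial> i ^^ k) f \<odot> (\<partial> i ^^ (N - k)) (g :: 'a osup)))"
proof (induction N)
  case 0
  show ?case by simp
next
  case (Suc N)
  define F where "F k l = (\<partial> i ^^ k) f \<odot> (\<partial> i ^^ l) g" for k l
  have i: "i \<in> \<Y>" using assms(3) by (simp add: YY_iff)
  have step: "\<partial> i (F k l) = F (Suc k) l + F k (Suc l)" for k l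
    unfolding F_def using assms i by (simp add: der_omul_even Oalg_der_funpow)
  have "(\<partial> i ^^ Suc N) (f \<odot> g)
      = (\<Sum>k\<le>N. of_nat (N choose k) \<bullet> F (Suc k) (N - k)) + (\<Sum>k\<le>N. of_nat (N choose k) \<bullet> F k (Suc N - k))"
    using Suc by (simp add: F_def [symmetric] der.sum der_scale step ospace.scale_right_distrib
        sum.distrib Suc_diff_le)
  also have "(\<Sum>k\<le>N. of_nat (N choose k) \<bullet> F k (Suc N - k))
      = (\<Sum>k\<le>Suc N. of_nat (N choose k) \<bullet> F k (Suc N - k))"
    by (simp add: binomial_eq_0)
  also have "\<dots> = F 0 (Suc N) + (\<Sum>k\<le>N. of_nat (N choose Suc k) \<bullet> F (Suc k) (N - k))"
    by (subst sum.atMost_Suc_shift) simp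
  also have "(\<Sum>k\<le>N. of_nat (N choose k) \<bullet> F (Suc k) (N - k)) + \<dots>
      = (\<Sum>k\<le>Suc N. of_nat (Suc N choose k) \<bullet> F k (Suc N - k))"
    by (subst sum.atMost_Suc_shift) (simp add: ospace.scale_left_distrib sum.distrib algebra_simps)
  finally show ?case by (simp only: F_def)
qed

text \<open>
  Among the binomial coefficients of order \<open>p^q\<close> only the two outer ones are nonzero in \<open>'a\<close>.
\<close>

lemma der_prime_power_omul:
  assumes "f \<in> \<O>" "g \<in> \<O>" "i \<in> Y0 m"
  shows "(\<partial> i ^^ (p ^ q)) (f \<odot> g) = (\<partial> i ^^ (p ^ q)) f \<odot> g + f \<odot> (\<partial> i ^^ (p ^ q)) (g :: 'a osup)"
proof -
  have pos: "0 < p ^ q" using prime_gt_0_nat [OF prime] by simp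
  have "(\<partial> i ^^ (p ^ q)) (f \<odot> g)
    = (\<Sum>k\<in>{0, p ^ q}. of_nat (p ^ q choose k) \<bullet> ((\<partial> i ^^ k) f \<odot> (\<partial> i ^^ (p ^ q - k)) g))"
    unfolding der_funpow_omul [OF assms]
  proof (rule sum.mono_neutral_right)
    show "\<forall>k\<in>{..p ^ q} - {0, p ^ q}.
        of_nat (p ^ q choose k) \<bullet> ((\<partial> i ^^ k) f \<odot> (\<partial> i ^^ (p ^ q - k)) g) = 0"
    proof
      fix k assume "k \<in> {..p ^ q} - {0, p ^ q}"
      then have "0 < k" "k < p ^ q" by auto
      then show "of_nat (p ^ q choose k) \<bullet> ((\<partial> i ^^ k) f \<odot> (\<partial> i ^^ (p ^ q - k)) g) = 0"
        using of_nat_prime_power_choose [OF prime char] by simp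
    qed
  qed auto
  then show ?thesis using pos by (simp add: add.commute)
qed

section \<open>Brackets of Hamiltonian superderivations\<close>

text \<open>
  Where \<open>\<partial>_j\<close> meets the second factor \<open>\<partial>_k g\<close>, it passes \<open>\<partial>_k\<close> and gives \<open>{f, \<partial>_j g}\<close>.  Where it meets the
  first factor, the factors have to be exchanged and the sum reindexed by \<open>k \<mapsto> k'\<close>, which turns it
  into \<open>- {g, \<partial>_j f}\<close>.
\<close>

lemma der_poisson:
  assumes f: "f \<in> (homog 0 :: 'a osup set)" and g: "g \<in> homog 0" and j: "j \<in> \<Y>"
  shows "\<partial> j (poisson f g) = poisson f (\<partial> j g) - poisson g (\<partial> j f)"
proof -
  note O = homog_subset_Oalg [OF f] homog_subset_Oalg [OF g]
  have first: "\<partial> j (\<partial> (prm m k) f) \<odot> \<partial> k g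
      = (- 1) ^ par m k \<bullet> (\<partial> k g \<odot> \<partial> (prm m k) (\<partial> j f))" if k: "k \<in> \<Y>" for k
  proof -
    have "\<partial> j (\<partial> (prm m k) f) = (- 1) ^ (par m j * par m k) \<bullet> \<partial> (prm m k) (\<partial> j f)"
      using der_swap [OF O(1) j prm_in [OF k]] k by simp
    moreover have "\<partial> (prm m k) (\<partial> j f) \<odot> \<partial> k g
        = (- 1) ^ (par m k * (par m j + par m k)) \<bullet> (\<partial> k g \<odot> \<partial> (prm m k) (\<partial> j f))"
      using omul_supercommute [OF homog_der [OF g k] homog_der_prm [OF homog_der [OF f j] k]] by simp
    moreover have "(- 1) ^ (par m j * par m k) * (- 1) ^ (par m k * (par m j + par m k)) = ((- 1) ^ par m k :: 'a)"
      by (simp add: par_def)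
    ultimately show ?thesis by (simp add: omul_scale_left)
  qed
  have second: "(- 1) ^ (par m j * par m k) \<bullet> (\<partial> (prm m k) f \<odot> \<partial> j (\<partial> k g))
      = \<partial> (prm m k) f \<odot> \<partial> k (\<partial> j g)" if k: "k \<in> \<Y>" for k
    using der_swap [OF O(2) j k] by (simp add: omul_scale_right par_def)
  have "\<partial> j (\<partial> (prm m k) f \<odot> \<partial> k g)
      = \<partial> (prm m k) f \<odot> \<partial> k (\<partial> j g) + (- 1) ^ par m k \<bullet> (\<partial> k g \<odot> \<partial> (prm m k) (\<partial> j f))"
    if k: "k \<in> \<Y>" for k
    using der_omul [OF homog_der_prm [OF f k] Oalg_der [OF O(2) k] j] first [OF k] second [OF k] by simp
  then have "\<partial> j (poisson f g) = (\<Sum>k\<in>\<Y>. tau m (prm m k) \<bullet> (\<partial> (prm m k) f \<odot> \<partial> k (\<partial> j g)))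
      + (\<Sum>k\<in>\<Y>. ((- 1) ^ par m k * tau m (prm m k)) \<bullet> (\<partial> k g \<odot> \<partial> (prm m k) (\<partial> j f)))"
    by (simp add: poisson_def der.sum der_scale ospace.scale_right_distrib sum.distrib mult.commute)
  also have "(\<Sum>k\<in>\<Y>. ((- 1) ^ par m k * tau m (prm m k)) \<bullet> (\<partial> k g \<odot> \<partial> (prm m k) (\<partial> j f)))
      = - poisson g (\<partial> j f)"
    unfolding poisson_def by (simp add: tau_prm_reindex)
  finally show ?thesis unfolding poisson_def diff_conv_add_uminus .
qed

text \<open>
  The coefficients of \<open>\<partial>_k\<close> on both sides are \<open>\<tau>(k')\<close> times the two sides of \<open>der_poisson\<close> for \<open>\<partial>_k'\<close>.
\<close>

lemma bracket_DH:
  assumes "f \<in> (homog 0 :: 'a osup set)" "g \<in> homog 0"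
  shows "bracket p m n t (DH p m n t f) (DH p m n t g) = DH p m n t (poisson f g)"
proof
  fix k
  show "bracket p m n t (DH p m n t f) (DH p m n t g) k = DH p m n t (poisson f g) k"
  proof (cases "k \<in> \<Y>")
    case True
    show ?thesis
      using True der_poisson [OF assms prm_in [OF True]]
      by (simp add: bracket_even DH_Weven assms DH_even poisson_even act_scale act_DH
          ospace.scale_right_diff_distrib)
  qed (simp add: bracket_even DH_Weven assms DH_even poisson_even)
qed

text \<open>
  Integration by parts: \<open>{f, g}\<close> is \<open>\<Sum>k. \<tau>(k') \<partial>_k'(f \<partial>_k g)\<close> minus \<open>f\<close> times the second-order operator that
  vanishes by \<open>Laplacian_zero\<close>.  What is left is a sum of derivatives.
\<close>

lemma poisson_in_Hpre:
  assumes two: "(2 :: 'a) \<noteq> 0" and f: "f \<in> (homog 0 :: 'a osup set)" and g: "g \<in> homog 0"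
  shows "poisson f g \<in> Hpre p m n t"
proof -
  note O = homog_subset_Oalg [OF f] homog_subset_Oalg [OF g]
  have "\<partial> (prm m k) f \<odot> \<partial> k g = \<partial> (prm m k) (f \<odot> \<partial> k g) - f \<odot> \<partial> (prm m k) (\<partial> k g)"
    if k: "k \<in> \<Y>" for k
    using der_omul [OF f Oalg_der [OF O(2) k] prm_in [OF k]] by simp
  then have "poisson f g = (\<Sum>k\<in>\<Y>. tau m (prm m k) \<bullet> \<partial> (prm m k) (f \<odot> \<partial> k g))
      - f \<odot> (\<Sum>k\<in>\<Y>. tau m (prm m k) \<bullet> \<partial> (prm m k) (\<partial> k g))"
    by (simp add: poisson_def omul_right.sum omul_scale_right ospace.scale_right_diff_distrib sum_subtractf)
  then have "poisson f g = (\<Sum>k\<in>\<Y>. tau m (prm m k) \<bullet> \<partial> (prm m k) (f \<odot> \<partial> k g))"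
    by (simp add: Laplacian_zero [OF two O(2)])
  then have "poisson f g (\<pi>, Y1 m n) = 0"
    using O by (simp add: osum_apply [where k = "(\<pi>, Y1 m n)"] oscale_apply der_top_coefficient Oalg_omul Oalg_der)
  then show ?thesis using poisson_even [OF f g] by (simp add: Hpre_iff)
qed

text \<open>
  No signs occur because \<open>f\<close>, being even, commutes with the coefficients of \<open>A\<close>.
\<close>

lemma act_omul:
  assumes A: "A \<in> Weven p m n t" and f: "f \<in> (homog 0 :: 'a osup set)" and g: "g \<in> \<O>"
  shows "act A (f \<odot> g) = act A f \<odot> g + f \<odot> act A g"
proof -
  have "A k \<odot> \<partial> k (f \<odot> g) = (A k \<odot> \<partial> k f) \<odot> g + f \<odot> (A k \<odot> \<partial> k g)" if k: "k \<in> \<Y>" for k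
  proof -
    have Ak: "A k \<in> homog (par m k)" using A k by (auto simp: Weven_iff)
    note O = homog_subset_Oalg [OF Ak] homog_subset_Oalg [OF f] g Oalg_der [OF g k]
      Oalg_der [OF homog_subset_Oalg [OF f] k]
    have "A k \<odot> f = f \<odot> A k" using omul_supercommute [OF f Ak] by simp
    then show ?thesis
      using der_omul [OF f g k] O by (simp add: omul_add_right flip: omul_assoc)
  qed
  then show ?thesis
    by (simp add: act_def sum.distrib omul_left.sum omul_right.sum)
qed

text \<open>
  The bracket of \<open>D_H(f)\<close> with \<open>g D_H(h)\<close> differs from \<open>{f, g} D_H(h)\<close> by \<open>g [D_H(f), D_H(h)]\<close>, which is
  \<open>g D_H({f, h}) = 0\<close>.
\<close>

lemma bracket_DH_wact:
  assumes f: "f \<in> (homog 0 :: 'a osup set)" and g: "g \<in> homog 0" and h: "h \<in> homog 0"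
    and fh: "poisson f h = 0"
  shows "bracket p m n t (DH p m n t f) (wact p m n t g (DH p m n t h))
    = wact p m n t (poisson f g) (DH p m n t h)"
proof
  fix k
  let ?F = "DH p m n t f" and ?H = "DH p m n t h"
  note W = DH_Weven [OF f] DH_Weven [OF h]
  have Hk: "?H k \<in> \<O>" for k
    using W(2) by (auto simp: Weven_iff dest: homog_subset_Oalg split: if_splits)
  have wg: "wact p m n t g ?H \<in> Weven p m n t"
    by (rule wact_DH_Weven [OF g h])
  have Fk: "?F k \<in> \<O>"
    using W(1) by (auto simp: Weven_iff dest: homog_subset_Oalg split: if_splits)
  have "act (wact p m n t g ?H) (?F k) = g \<odot> act ?H (?F k)"
    using homog_subset_Oalg [OF g] Hk Fk
    by (simp add: act_def wact_def omul_right.sum omul_assoc Oalg_der)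
  moreover have "act ?F (?H k) - act ?H (?F k) = 0"
    using bracket_DH [OF f h] fh bracket_even [OF W, of k] by (simp add: zero_fun_apply)
  ultimately show "bracket p m n t ?F (wact p m n t g ?H) k = wact p m n t (poisson f g) ?H k"
    unfolding bracket_even [OF W(1) wg]
    using act_omul [OF W(1) g Hk, of k] act_DH [OF f, of g]
    by (simp add: wact_def)
qed

lemma der_prime_power_poisson:
  assumes "f \<in> (\<O> :: 'a osup set)" "g \<in> \<O>" "i \<in> Y0 m"
  shows "(\<partial> i ^^ (p ^ q)) (poisson f g)
    = poisson ((\<partial> i ^^ (p ^ q)) f) g + poisson f ((\<partial> i ^^ (p ^ q)) g)"
  using assms
  by (simp add: poisson_def der_funpow_sum der_funpow_scale der_prime_power_omul Oalg_der
      der_funpow_commute ospace.scale_right_distrib sum.distrib)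

end

end

theorem proposition3p1:
  fixes p m n i q :: nat and t :: "nat \<Rightarrow> nat"
  assumes "CHAR('a::field) = p" and "p > 3"
    and "m > 1" and "n > 3"
    and "\<And>j. j \<in> Y0 m \<Longrightarrow> t j > 0"
    and "even n"
    and "i \<in> Y0 m" and "q > 0"
  shows "(Phi p m n t i q :: 'a wsup \<Rightarrow> 'a wsup) \<in> DerHW p m n t"
proof -
  have char: "of_nat p = (0 :: 'a)" using assms(1) of_nat_CHAR by blast
  have prime: "prime p" using prime_CHAR_semidom [where 'a = 'a] assms(1,2) by simp
  have "\<not> p dvd 2" using assms(2) by (auto dest: dvd_imp_le)
  then have two: "(2 :: 'a) \<noteq> 0"
    using of_nat_eq_0_iff_char_dvd [of 2, where 'a = 'a] assms(1) by simp
  let ?D = "Phi p m n t i q :: 'a wsup \<Rightarrow> 'a wsup"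
  let ?H = "DH p m n t :: 'a osup \<Rightarrow> 'a wsup"
  let ?P = "Hpre p m n t :: 'a osup set"
  let ?w = "mon 0 (Y1 m n) :: 'a osup"
  define T where "T = (der p m n t i ^^ (p ^ q) :: 'a osup \<Rightarrow> 'a osup)"
  note pc = prime char
  have linear: "Vector_Spaces.linear oscale wscale ?H" by (rule linear_DH)
  have D: "?D (?H f) = wact p m n t (T f) (?H ?w)" if "f \<in> ?P" for f
    unfolding T_def using assms(2) by (intro Phi_DH [OF assms(7) _ that]) simp
  have even: "f \<in> homog p m n t 0" if "f \<in> ?P" for f
    using that Hpre_iff by blast
  have T_even: "T f \<in> homog p m n t 0" if "f \<in> ?P" for f
    unfolding T_def using even [OF that] assms(7) by (rule homog_der_funpow)
  have w: "?w \<in> homog p m n t 0"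
    using assms(6) by (intro homog_mon) (auto simp: AA_def BB_def Y1_def zero_fun_apply)
  have Poisson_w: "poisson p m n t f ?w = 0" if "f \<in> ?P" for f
    using poisson_top_monomial [OF assms(6) even [OF that]] .
  have subspace: "f + g \<in> ?P" "oscale c f \<in> ?P" if "f \<in> ?P" "g \<in> ?P" for f g c
    using that unfolding Hpre_def by (simp_all add: ospace.span_add ospace.span_scale)
  have "?D (?H f) \<in> Weven p m n t" if "f \<in> ?P" for f
    unfolding D [OF that] using wact_DH_Weven [OF T_even [OF that] w] .
  moreover have "?D (?H f + ?H g) = ?D (?H f) + ?D (?H g)" if "f \<in> ?P" "g \<in> ?P" for f g
  proof -
    have "?H f + ?H g = ?H (f + g)" using linear by (simp add: Vector_Spaces.linear_iff)
    then show ?thesis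
      using that subspace by (simp add: D T_def der_funpow_add wact_add)
  qed
  moreover have "?D (wscale c (?H f)) = wscale c (?D (?H f))" if "f \<in> ?P" for c f
  proof -
    have "wscale c (?H f) = ?H (oscale c f)" using linear by (simp add: Vector_Spaces.linear_iff)
    then show ?thesis
      using that subspace by (simp add: D T_def der_funpow_scale wact_scale)
  qed
  moreover have "?D (bracket p m n t (?H f) (?H g))
      = bracket p m n t (?H f) (?D (?H g)) - bracket p m n t (?H g) (?D (?H f))"
    if f: "f \<in> ?P" and g: "g \<in> ?P" for f g
  proof -
    have "?D (bracket p m n t (?H f) (?H g)) = wact p m n t (T (poisson p m n t f g)) (?H ?w)"
      using bracket_DH [OF pc even [OF f] even [OF g]] D [OF poisson_in_Hpre [OF pc two even [OF f] even [OF g]]]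
      by simp
    also have "T (poisson p m n t f g) = poisson p m n t f (T g) - poisson p m n t g (T f)"
      using der_prime_power_poisson [OF pc homog_subset_Oalg [OF even [OF f]] homog_subset_Oalg [OF even [OF g]] assms(7), of q]
        poisson_skew [OF T_even [OF f] even [OF g]]
      by (simp add: T_def)
    also have "wact p m n t \<dots> (?H ?w)
        = bracket p m n t (?H f) (?D (?H g)) - bracket p m n t (?H g) (?D (?H f))"
      using bracket_DH_wact [OF pc even [OF f] T_even [OF g] w Poisson_w [OF f]]
        bracket_DH_wact [OF pc even [OF g] T_even [OF f] w Poisson_w [OF g]]
      by (simp add: wact_diff D f g)
    finally show ?thesis .
  qed
  ultimately show ?thesis
    unfolding DerHW_def HH_eq by blast
qed

end
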